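(* For all integers $n\ge 0$ and $k\ge 1$, \[ \dim_{\mathbb{Q}}\rho_n(\check{\mathfrak{H}}_{k}^1) =\frac{1}{n+k}\sum_{m\mid n+k}\varphi\Bigl(\frac{n+k}{m}\Bigr)\bigl(2^m-L_m^n\bigr)-2, \] where the sum runs over the positive divisors $m$ of $n+k$ and $\varphi$ is Euler's totient function.
   Context: Let $\mathfrak{H}=\mathbb{Q}\langle x,y\rangle$ be the noncommutative polynomial algebra over $\mathbb{Q}$ in two indeterminates $x,y$; put $z=x+y$ and $z_k=x^{k-1}y$ for $k\ge1$. For $k\ge1$, let $\check{\mathfrak{H}}_k^1$ be the $\mathbb{Q}$-span of all monomials $z_{k_1}\cdots z_{k_l}$ with $l\ge1$, $k_i\ge1$, $k_1+\dots+k_l=k$ and not all $k_i$ equal to $1$ (equivalently, of all monomials of degree $k$ in $x,y$ ending in $y$ that are not a power of $y$). For $n\ge0$, make $\mathfrak{H}^{\otimes(n+2)}$ (tensor power over $\mathbb{Q}$) an $\mathfrak{H}$-bimodule via $a\diamond(w_1\otimes\cdots\otimes w_{n+2})\diamond b=w_1b\otimes w_2\otimes\cdots\otimes w_{n+1}\otimes aw_{n+2}$. Let $\mathcal{C}_n\colon\mathfrak{H}\to\mathfrak{H}^{\otimes(n+2)}$ be the $\mathbb{Q}$-linear map with $\mathcal{C}_n(1)=0$, $\mathcal{C}_n(x)=x\otimes z^{\otimes n}\otimes y$, $\mathcal{C}_n(y)=-x\otimes z^{\otimes n}\otimes y$, and $\mathcal{C}_n(ww')=\mathcal{C}_n(w)\diamond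 w'+w\diamond\mathcal{C}_n(w')$. Let $M_n\colon\mathfrak{H}^{\otimes(n+2)}\to\mathfrak{H}$ be $M_n(w_1\otimes\cdots\otimes w_{n+2})=w_1\cdots w_{n+2}$, and set $\rho_n=M_n\circ\mathcal{C}_n$. For $n\ge1$, the $n$-step Lucas sequence $(L_m^n)_{m\ge1}$ is defined by $L_m^n=2^m-1$ for $m=1,\dots,n$ and $L_m^n=L_{m-1}^n+\cdots+L_{m-n}^n$ for $m\ge n+1$; by convention $L_m^0=0$ for all $m\ge1$. *)

theory Defs
  imports
    "HOL-Library.Poly_Mapping"
    "HOL-Number_Theory.Totient"
begin

section \<open>Free vector spaces\<close>

definition scale :: "rat \<Rightarrow> ('a \<Rightarrow>\<^sub>0 rat) \<Rightarrow> ('a \<Rightarrow>\<^sub>0 rat)" where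
  "scale c p = Poly_Mapping.map ((*) c) p"

lemma lookup_scale [simp]: "Poly_Mapping.lookup (scale c p) i = c * Poly_Mapping.lookup p i"
  by (simp add: scale_def Poly_Mapping.map.rep_eq when_def)

lemma scale_single [simp]: "scale c (Poly_Mapping.single a d) = Poly_Mapping.single a (c * d)"
  by (rule poly_mapping_eqI) (simp add: lookup_single when_def)

interpretation pm: vector_space "scale :: rat \<Rightarrow> ('a \<Rightarrow>\<^sub>0 rat) \<Rightarrow> ('a \<Rightarrow>\<^sub>0 rat)"
  by unfold_locales (auto intro!: poly_mapping_eqI simp: lookup_add algebra_simps)

definition linext :: "('a \<Rightarrow> ('b \<Rightarrow>\<^sub>0 rat)) \<Rightarrow> ('a \<Rightarrow>\<^sub>0 rat) \<Rightarrow> ('b \<Rightarrow>\<^sub>0 rat)" where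
  "linext f p = (\<Sum>a \<in> Poly_Mapping.keys p. scale (Poly_Mapping.lookup p a) (f a))"

lemma linext_superset:
  assumes "finite S" "Poly_Mapping.keys p \<subseteq> S"
  shows "linext f p = (\<Sum>a \<in> S. scale (Poly_Mapping.lookup p a) (f a))"
  unfolding linext_def
  by (rule sum.mono_neutral_left) (use assms in \<open>auto simp: in_keys_iff\<close>)

lemma linext_single [simp]: "linext f (Poly_Mapping.single a c) = scale c (f a)"
  by (cases "c = 0") (simp_all add: linext_def)

lemma linext_zero [simp]: "linext f 0 = 0"
  by (simp add: linext_def)

lemma linext_add: "linext f (p + q) = linext f p + linext f q"
proof -
  let ?S = "Poly_Mapping.keys p \<union> Poly_Mapping.keys q"
  have "linext f (p + q) = (\<Sum>a \<in> ?S. scale (Poly_Mapping.lookup (p + q) a) (f a))"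
    by (rule linext_superset) (simp_all add: Poly_Mapping.keys_add)
  also have "\<dots> = (\<Sum>a \<in> ?S. scale (Poly_Mapping.lookup p a) (f a)) + (\<Sum>a \<in> ?S. scale (Poly_Mapping.lookup q a) (f a))"
    by (simp add: lookup_add pm.scale_left_distrib sum.distrib)
  also have "\<dots> = linext f p + linext f q"
    by (simp add: linext_superset[of ?S])
  finally show ?thesis .
qed

lemma linext_scale: "linext f (scale c p) = scale c (linext f p)"
proof -
  have "linext f (scale c p) = (\<Sum>a \<in> Poly_Mapping.keys p. scale (Poly_Mapping.lookup (scale c p) a) (f a))"
    by (rule linext_superset) (auto simp: in_keys_iff)
  then show ?thesis
    by (simp add: linext_def pm.scale_sum_right)
qed

section \<open>The noncommutative polynomial algebra and its tensor powers\<close>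

text \<open>Lists form the free monoid under concatenation, so that the convolution product of
  \<^theory>\<open>HOL-Library.Poly_Mapping\<close> makes finitely supported functions on lists over an alphabet
  the free associative algebra on that alphabet.\<close>

instantiation list :: (type) monoid_add
begin
definition zero_list :: "'a list" where "zero_list = []"
definition plus_list :: "'a list \<Rightarrow> 'a list \<Rightarrow> 'a list" where "plus_list = (@)"
instance by standard (simp_all add: zero_list_def plus_list_def)
end

datatype letter = Lx | Ly

type_synonym word = "letter list"
type_synonym H = "word \<Rightarrow>\<^sub>0 rat"

definition mon :: "word \<Rightarrow> H" where
  "mon w = Poly_Mapping.single w 1"

definition hx :: H where "hx = mon [Lx]"
definition hy :: H where "hy = mon [Ly]"
definition hz :: H where "hz = hx + hy"

definition zk :: "nat \<Rightarrow> H" where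
  "zk k = hx ^ (k - 1) * hy"

definition Hcheck :: "nat \<Rightarrow> H set" where
  "Hcheck k = pm.span {prod_list (map zk ks) | ks.
     ks \<noteq> [] \<and> (\<forall>i \<in> set ks. i \<ge> 1) \<and> sum_list ks = k \<and> \<not> (\<forall>i \<in> set ks. i = 1)}"

text \<open>The full tensor algebra of \<^typ>\<open>H\<close>. A basis of the \<open>N\<close>-th tensor power is given by the pure
  tensors of \<open>N\<close> words, which are encoded as the word lists of length \<open>N\<close>; the product of this
  type is then the concatenation of tensors.\<close>

type_synonym TH = "word list \<Rightarrow>\<^sub>0 rat"

definition tpower :: "nat \<Rightarrow> TH set" where
  "tpower N = {t. \<forall>ws \<in> Poly_Mapping.keys t. length ws = N}"

definition emb :: "H \<Rightarrow> TH" where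
  "emb = linext (\<lambda>w. Poly_Mapping.single [w] 1)"

definition tensor :: "H list \<Rightarrow> TH" where
  "tensor ps = prod_list (map emb ps)"

text \<open>The two actions \<open>a \<diamond> t\<close> and \<open>t \<diamond> b\<close>. Only their restrictions to \<^term>\<open>tpower N\<close> with
  \<open>N \<ge> 2\<close> are of interest. Their values on pure tensors of arbitrary elements are given by
  \<open>lact_tensor\<close> and \<open>ract_tensor\<close> below.\<close>

definition lact :: "H \<Rightarrow> TH \<Rightarrow> TH" where
  "lact a t = linext (\<lambda>u. linext (\<lambda>ws. Poly_Mapping.single (butlast ws @ [u @ last ws]) 1) t) a"

definition ract :: "TH \<Rightarrow> H \<Rightarrow> TH" where
  "ract t b = linext (\<lambda>u. linext (\<lambda>ws. Poly_Mapping.single ((hd ws @ u) # tl ws) 1) t) b"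

fun C_letter :: "nat \<Rightarrow> letter \<Rightarrow> TH" where
  "C_letter n Lx = tensor ([hx] @ replicate n hz @ [hy])"
| "C_letter n Ly = - tensor ([hx] @ replicate n hz @ [hy])"

fun C_word :: "nat \<Rightarrow> word \<Rightarrow> TH" where
  "C_word n [] = 0"
| "C_word n (a # w) = ract (C_letter n a) (mon w) + lact (mon [a]) (C_word n w)"

text \<open>The Leibniz rule for arbitrary products is \<open>C_mult\<close> below.\<close>

definition C_map :: "nat \<Rightarrow> H \<Rightarrow> TH" where
  "C_map n = linext (C_word n)"

text \<open>The maps \<open>M\<^sub>n\<close> for all \<open>n\<close> at once: \<open>M\<^sub>n\<close> is the restriction to \<^term>\<open>tpower (n + 2)\<close>.\<close>

definition M_map :: "TH \<Rightarrow> H" where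
  "M_map = linext (\<lambda>ws. mon (concat ws))"

definition rho :: "nat \<Rightarrow> H \<Rightarrow> H" where
  "rho n = M_map \<circ> C_map n"

section \<open>The \<open>n\<close>-step Lucas sequence\<close>

text \<open>The value at \<open>m = 0\<close> is irrelevant.\<close>

function lucas :: "nat \<Rightarrow> nat \<Rightarrow> int" where
  "lucas n m = (if n = 0 then 0 else if m \<le> n then 2 ^ m - 1 else (\<Sum>i = 1..n. lucas n (m - i)))"
  by pat_completeness auto
termination by (relation "measure snd") auto

declare lucas.simps [simp del]

section \<open>The defining properties of the maps\<close>

lemma poly_mapping_induct_single:
  fixes p :: "'a \<Rightarrow>\<^sub>0 rat"
  assumes "P 0" "\<And>a c p. P p \<Longrightarrow> P (Poly_Mapping.single a c + p)"
  shows "P p"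
proof -
  have *: "P (\<Sum>a \<in> A. Poly_Mapping.single a (Poly_Mapping.lookup p a))" if "finite A" for A
    using that by (induction A) (simp_all add: assms)
  have "p = (\<Sum>a \<in> Poly_Mapping.keys p. Poly_Mapping.single a (Poly_Mapping.lookup p a))"
    by (rule poly_mapping_eqI)
      (simp add: lookup_sum lookup_single when_def in_keys_iff)
  with *[of "Poly_Mapping.keys p"] show ?thesis by simp
qed

lemma linext_fun_add: "linext (\<lambda>u. f u + g u) p = linext f p + linext g p"
  by (simp add: linext_def pm.scale_right_distrib sum.distrib)

lemma linext_fun_scale: "linext (\<lambda>u. scale c (f u)) p = scale c (linext f p)"
  by (simp add: linext_def pm.scale_sum_right mult.commute)

lemma linext_fun_zero [simp]: "linext (\<lambda>u. 0) p = 0"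
  by (simp add: linext_def)

lemma emb_add: "emb (p + q) = emb p + emb q"
  and emb_scale: "emb (scale c p) = scale c (emb p)"
  by (simp_all add: emb_def linext_add linext_scale)

lemma scale_eq_mult: "scale c p = Poly_Mapping.single 0 c * p"
  for p :: "'a::monoid_add \<Rightarrow>\<^sub>0 rat"
proof (induction p rule: poly_mapping_induct_single)
  case (2 a d p)
  then show ?case
    by (simp add: pm.scale_right_distrib distrib_left mult_single)
qed simp

lemma scale_mult_left: "scale c p * q = scale c (p * q)"
  for p q :: "'a::monoid_add \<Rightarrow>\<^sub>0 rat"
  by (simp add: scale_eq_mult mult.assoc)

lemma scale_mult_right: "p * scale c q = scale c (p * q)"
  for p q :: "'a::monoid_add \<Rightarrow>\<^sub>0 rat"
proof (induction p rule: poly_mapping_induct_single)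
  case (2 a d p)
  have "Poly_Mapping.single a d * scale c q = scale c (Poly_Mapping.single a d * q)"
    by (simp add: scale_eq_mult mult_single mult.commute flip: mult.assoc)
  with 2 show ?case
    by (simp add: pm.scale_right_distrib distrib_right)
qed simp

lemma tensor_add: "tensor (ps @ [p + q] @ qs) = tensor (ps @ [p] @ qs) + tensor (ps @ [q] @ qs)"
  by (simp add: tensor_def emb_add algebra_simps)

lemma tensor_scale: "tensor (ps @ [scale c p] @ qs) = scale c (tensor (ps @ [p] @ qs))"
  by (simp add: tensor_def emb_scale scale_mult_left scale_mult_right)

lemma tensor_Cons: "tensor (p # ps) = emb p * tensor ps"
  and tensor_append: "tensor (ps @ qs) = tensor ps * tensor qs"
  by (simp_all add: tensor_def)

lemma tensor_mon: "tensor (map mon ws) = Poly_Mapping.single ws 1"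
proof (induction ws)
  case Nil
  show ?case by (simp add: tensor_def zero_list_def flip: single_one)
next
  case (Cons w ws)
  then show ?case
    by (simp add: tensor_Cons) (simp add: emb_def mon_def mult_single plus_list_def)
qed

lemma lact_simps [simp]:
  "lact (a + b) t = lact a t + lact b t"
  "lact (scale c a) t = scale c (lact a t)"
  "lact a (t + t') = lact a t + lact a t'"
  "lact a (scale c t) = scale c (lact a t)"
  "lact 0 t = 0" "lact a 0 = 0"
  by (simp_all add: lact_def linext_add linext_scale linext_fun_add linext_fun_scale)

lemma ract_simps [simp]:
  "ract t (a + b) = ract t a + ract t b"
  "ract t (scale c a) = scale c (ract t a)"
  "ract (t + t') a = ract t a + ract t' a"
  "ract (scale c t) a = scale c (ract t a)"
  "ract t 0 = 0" "ract 0 a = 0"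
  by (simp_all add: ract_def linext_add linext_scale linext_fun_add linext_fun_scale)

lemma lact_single:
  "lact (Poly_Mapping.single u c) (Poly_Mapping.single ws d) =
     Poly_Mapping.single (butlast ws @ [u @ last ws]) (c * d)"
  by (simp add: lact_def)

lemma ract_single:
  "ract (Poly_Mapping.single ws d) (Poly_Mapping.single u c) =
     Poly_Mapping.single ((hd ws @ u) # tl ws) (c * d)"
  by (simp add: ract_def)

lemma lact_mult_emb: "lact a (t * emb q) = t * emb (a * q)"
proof (induction a rule: poly_mapping_induct_single)
  case 1
  then show ?case by (simp add: emb_def)
next
  case (2 u c a)
  have "lact (Poly_Mapping.single u c) (t * emb q) = t * emb (Poly_Mapping.single u c * q)"
  proof (induction t rule: poly_mapping_induct_single)
    case (2 ws d t)
    have "lact (Poly_Mapping.single u c) (Poly_Mapping.single ws d * emb q) =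
        Poly_Mapping.single ws d * emb (Poly_Mapping.single u c * q)"
      by (induction q rule: poly_mapping_induct_single)
        (simp_all add: emb_def linext_add distrib_left mult_single plus_list_def lact_single mult_ac)
    with 2 show ?case by (simp add: distrib_right)
  qed simp
  with 2 show ?case by (simp add: distrib_right distrib_left emb_add)
qed

lemma ract_emb_mult: "ract (emb p * t) b = emb (p * b) * t"
proof (induction b rule: poly_mapping_induct_single)
  case 1
  then show ?case by (simp add: emb_def)
next
  case (2 u c b)
  have "ract (emb p * t) (Poly_Mapping.single u c) = emb (p * Poly_Mapping.single u c) * t"
  proof (induction t rule: poly_mapping_induct_single)
    case (2 ws d t)
    have "ract (emb p * Poly_Mapping.single ws d) (Poly_Mapping.single u c) =
        emb (p * Poly_Mapping.single u c) * Poly_Mapping.single ws d"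
      by (induction p rule: poly_mapping_induct_single)
        (simp_all add: emb_def linext_add distrib_right mult_single plus_list_def ract_single mult_ac)
    with 2 show ?case by (simp add: distrib_left)
  qed simp
  with 2 show ?case by (simp add: distrib_right distrib_left emb_add)
qed

lemma lact_tensor: "lact a (tensor (ps @ [q])) = tensor (ps @ [a * q])"
  by (simp add: tensor_append tensor_Cons lact_mult_emb) (simp add: tensor_def lact_mult_emb)

lemma ract_tensor: "ract (tensor (p # ps)) b = tensor (p * b # ps)"
  by (simp add: tensor_Cons ract_emb_mult)

lemma M_tensor: "M_map (tensor ps) = prod_list ps"
proof -
  have M_add: "M_map (s + t) = M_map s + M_map t" for s t
    by (simp add: M_map_def linext_add)
  have M_emb_mult: "M_map (emb p * t) = p * M_map t" for p t
  proof (induction p rule: poly_mapping_induct_single)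
    case 1
    then show ?case by (simp add: emb_def M_map_def)
  next
    case (2 u c p)
    have "M_map (emb (Poly_Mapping.single u c) * t) = Poly_Mapping.single u c * M_map t"
      by (induction t rule: poly_mapping_induct_single)
        (simp_all add: M_map_def emb_def linext_add distrib_left mult_single plus_list_def mon_def)
    with 2 show ?case by (simp add: distrib_right emb_add M_add)
  qed
  have "M_map 1 = 1"
    by (simp add: M_map_def mon_def zero_list_def flip: single_one)
  then have "M_map (tensor []) = 1"
    by (simp add: tensor_def)
  then show ?thesis
    by (induction ps) (simp_all add: tensor_Cons M_emb_mult)
qed

lemma C_linear:
  "C_map n (p + q) = C_map n p + C_map n q" "C_map n (scale c p) = scale c (C_map n p)"
  by (simp_all add: C_map_def linext_add linext_scale)

lemma mon_append: "mon (u @ v) = mon u * mon v"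
  by (simp add: mon_def mult_single plus_list_def)

lemma C_mon: "C_map n (mon w) = C_word n w"
  by (simp add: C_map_def mon_def)

lemma one_eq_mon: "(1 :: H) = mon []"
  by (simp add: mon_def zero_list_def flip: single_one)

lemma C_one: "C_map n 1 = 0"
  by (simp add: one_eq_mon C_mon)

lemma C_hx: "C_map n hx = tensor ([hx] @ replicate n hz @ [hy])"
  and C_hy: "C_map n hy = - tensor ([hx] @ replicate n hz @ [hy])"
proof -
  have "ract (- t) b = - ract t b" for t b
    using ract_simps(4)[of "-1" t b] by simp
  then show "C_map n hx = tensor ([hx] @ replicate n hz @ [hy])"
    and "C_map n hy = - tensor ([hx] @ replicate n hz @ [hy])"
    by (simp_all add: hx_def hy_def C_mon ract_tensor flip: one_eq_mon)
qed

lemma tpower_closed: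
  "0 \<in> tpower N"
  "s \<in> tpower N \<Longrightarrow> t \<in> tpower N \<Longrightarrow> s + t \<in> tpower N"
  "s \<in> tpower N \<Longrightarrow> scale c s \<in> tpower N"
  by (auto simp: tpower_def in_keys_iff lookup_add)

lemma tpower_sum: "(\<And>i. i \<in> A \<Longrightarrow> f i \<in> tpower N) \<Longrightarrow> sum f A \<in> tpower N"
  by (induction A rule: infinite_finite_induct) (simp_all add: tpower_closed)

lemma tpower_linext:
  "(\<And>a. a \<in> Poly_Mapping.keys p \<Longrightarrow> f a \<in> tpower N) \<Longrightarrow> linext f p \<in> tpower N"
  unfolding linext_def by (intro tpower_sum tpower_closed)

lemma tpower_single: "length ws = N \<Longrightarrow> Poly_Mapping.single ws c \<in> tpower N"
  by (auto simp: tpower_def)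

lemma tpower_mult:
  assumes "s \<in> tpower K" "t \<in> tpower N"
  shows "s * t \<in> tpower (K + N)"
  using assms keys_mult[of s t] by (fastforce simp: tpower_def plus_list_def)

lemma tensor_in_tpower: "tensor ps \<in> tpower (length ps)"
proof (induction ps)
  case Nil
  then show ?case
    by (simp add: tensor_def tpower_single zero_list_def flip: single_one)
next
  case (Cons p ps)
  have "emb p \<in> tpower 1"
    unfolding emb_def by (intro tpower_linext tpower_single) simp
  from tpower_mult[OF this Cons] show ?case by (simp add: tensor_Cons)
qed

lemma lact_in_tpower: "t \<in> tpower N \<Longrightarrow> N \<ge> 1 \<Longrightarrow> lact a t \<in> tpower N"
  unfolding lact_def by (intro tpower_linext tpower_single) (auto simp: tpower_def)

lemma ract_in_tpower: "t \<in> tpower N \<Longrightarrow> N \<ge> 1 \<Longrightarrow> ract t b \<in> tpower N"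
  unfolding ract_def by (intro tpower_linext tpower_single) (auto simp: tpower_def)

lemma C_letter_in_tpower: "C_letter n a \<in> tpower (n + 2)"
proof -
  have "tensor ([hx] @ replicate n hz @ [hy]) \<in> tpower (n + 2)"
    using tensor_in_tpower[of "[hx] @ replicate n hz @ [hy]"] by simp
  moreover from tpower_closed(3)[OF this, of "-1"]
  have "- tensor ([hx] @ replicate n hz @ [hy]) \<in> tpower (n + 2)" by simp
  ultimately show ?thesis by (cases a) simp_all
qed

lemma C_word_in_tpower: "C_word n w \<in> tpower (n + 2)"
  by (induction w)
    (auto intro!: tpower_closed lact_in_tpower ract_in_tpower C_letter_in_tpower[simplified]
      simp: tpower_closed)

lemma C_in_tpower: "C_map n p \<in> tpower (n + 2)"
  unfolding C_map_def by (intro tpower_linext C_word_in_tpower)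

lemma tpower_induct [consumes 1, case_names zero add]:
  assumes "t \<in> tpower N" "P 0"
    "\<And>ws c t. length ws = N \<Longrightarrow> P t \<Longrightarrow> P (Poly_Mapping.single ws c + t)"
  shows "P t"
proof -
  have *: "P (\<Sum>a \<in> A. Poly_Mapping.single a (Poly_Mapping.lookup t a))"
    if "finite A" "A \<subseteq> {ws. length ws = N}" for A
    using that by (induction A) (simp_all add: assms)
  have "t = (\<Sum>a \<in> Poly_Mapping.keys t. Poly_Mapping.single a (Poly_Mapping.lookup t a))"
    by (rule poly_mapping_eqI)
      (simp add: lookup_sum lookup_single when_def in_keys_iff)
  with *[of "Poly_Mapping.keys t"] assms(1) show ?thesis by (auto simp: tpower_def)
qed

text \<open>The bimodule axioms.\<close>

lemma act_one:
  assumes "t \<in> tpower N" "N \<ge> 1"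
  shows "lact 1 t = t" "ract t 1 = t"
proof -
  have "lact 1 t = t \<and> ract t 1 = t"
    using assms(1)
  proof (induction rule: tpower_induct)
    case (add ws c t)
    with assms(2) have "ws \<noteq> []" by auto
    with add show ?case
      by (simp add: one_eq_mon mon_def lact_single ract_single)
  qed simp
  then show "lact 1 t = t" "ract t 1 = t" by auto
qed

lemma lact_lact: "lact (a * b) t = lact a (lact b t)"
proof (induction a rule: poly_mapping_induct_single)
  case (2 u c a)
  have "lact (Poly_Mapping.single u c * b) t = lact (Poly_Mapping.single u c) (lact b t)"
  proof (induction b rule: poly_mapping_induct_single)
    case (2 v d b)
    have "lact (Poly_Mapping.single u c * Poly_Mapping.single v d) t =
        lact (Poly_Mapping.single u c) (lact (Poly_Mapping.single v d) t)"
      by (induction t rule: poly_mapping_induct_single)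
        (simp_all add: lact_single mult_single plus_list_def mult_ac)
    with 2 show ?case by (simp add: distrib_left)
  qed simp
  with 2 show ?case by (simp add: distrib_right)
qed simp

lemma ract_ract: "ract t (a * b) = ract (ract t a) b"
proof (induction a rule: poly_mapping_induct_single)
  case (2 u c a)
  have "ract t (Poly_Mapping.single u c * b) = ract (ract t (Poly_Mapping.single u c)) b"
  proof (induction b rule: poly_mapping_induct_single)
    case (2 v d b)
    have "ract t (Poly_Mapping.single u c * Poly_Mapping.single v d) =
        ract (ract t (Poly_Mapping.single u c)) (Poly_Mapping.single v d)"
      by (induction t rule: poly_mapping_induct_single)
        (simp_all add: ract_single mult_single plus_list_def mult_ac)
    with 2 show ?case by (simp add: distrib_left)
  qed simp
  with 2 show ?case by (simp add: distrib_right)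
qed simp

lemma lact_ract:
  assumes "t \<in> tpower N" "N \<ge> 2"
  shows "lact a (ract t b) = ract (lact a t) b"
  using assms(1)
proof (induction rule: tpower_induct)
  case (add ws c t)
  from add(1) assms(2) obtain w v vs where ws: "ws = w # vs @ [v]"
    by (metis One_nat_def Suc_1 Suc_le_length_iff rev_exhaust list.distinct(1))
  have "lact a (ract (Poly_Mapping.single ws c) b) = ract (lact a (Poly_Mapping.single ws c)) b"
  proof (induction a rule: poly_mapping_induct_single)
    case (2 u d a)
    have "lact (Poly_Mapping.single u d) (ract (Poly_Mapping.single ws c) b) =
        ract (lact (Poly_Mapping.single u d) (Poly_Mapping.single ws c)) b"
      by (induction b rule: poly_mapping_induct_single)
        (simp_all add: ws lact_single ract_single mult_ac)
    with 2 show ?case by simp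
  qed simp
  with add show ?case by simp
qed simp

lemma C_mult: "C_map n (p * q) = ract (C_map n p) q + lact p (C_map n q)"
proof -
  have word: "C_word n (u @ v) = ract (C_word n u) (mon v) + lact (mon u) (C_word n v)" for u v
  proof (induction u)
    case Nil
    show ?case
      using act_one(1)[OF C_word_in_tpower] by (simp flip: one_eq_mon)
  next
    case (Cons a u)
    have "mon (a # u) = mon [a] * mon u"
      using mon_append[of "[a]" u] by simp
    with Cons show ?case
      by (simp add: mon_append ract_ract lact_lact lact_ract[OF C_word_in_tpower] add_ac)
  qed
  have single: "C_map n (Poly_Mapping.single u c * Poly_Mapping.single v d) =
      ract (C_map n (Poly_Mapping.single u c)) (Poly_Mapping.single v d) +
      lact (Poly_Mapping.single u c) (C_map n (Poly_Mapping.single v d))" for u c v d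
  proof -
    have *: "Poly_Mapping.single w e = scale e (mon w)" for w e
      by (simp add: mon_def)
    show ?thesis
      by (simp add: * C_linear C_mon scale_mult_left scale_mult_right word
          pm.scale_right_distrib mult.commute flip: mon_append)
  qed
  have C0: "C_map n 0 = 0" by (simp add: C_map_def)
  show ?thesis
  proof (induction p rule: poly_mapping_induct_single)
    case (2 u c p)
    have "C_map n (Poly_Mapping.single u c * q) =
        ract (C_map n (Poly_Mapping.single u c)) q + lact (Poly_Mapping.single u c) (C_map n q)"
      by (induction q rule: poly_mapping_induct_single)
        (simp_all add: C0 C_linear distrib_left single)
    with 2 show ?case by (simp add: C_linear distrib_right)
  qed (simp add: C0)
qed

end

theory Submission
  imports Defs
begin

text \<open>The derivation-like map \<open>\<C>\<^sub>n\<close> kills \<open>z = x + y\<close>, so it is best computed on words in the free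
  generators \<open>z\<close> and \<open>y\<close>. For such a word \<open>w\<close>, \<open>\<rho>\<^sub>n(w)\<close> is, up to sign and the outer factors \<open>x\<close> and \<open>y\<close>,
  the sum of all words obtained by cutting the cyclic word \<open>z\<^sup>n w\<close> open at an occurrence of \<open>y\<close>, which is
  deleted. Hence \<open>\<rho>\<^sub>n(w)\<close> depends only on the necklace of \<open>z\<^sup>n w\<close>, and distinct necklaces give
  elements with disjoint supports. In terms of \<open>z\<close> and \<open>y\<close>, the space \<open>Hcheck k\<close> consists of the
  combinations of words of length \<open>k\<close> ending in \<open>y\<close> whose coefficients sum to zero. So the dimension is the
  number of necklaces of length \<open>n + k\<close> which contain \<open>z\<^sup>n\<close>, minus one for the necklace \<open>z\<^bsup>n+k\<^esup>\<close> and
  minus one for the sum condition. These necklaces are counted with Burnside's lemma; the number of words of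
  period \<open>m\<close> avoiding \<open>z\<^sup>n\<close> is \<open>L\<^sub>m\<^sup>n\<close>, as deleting the block \<open>z\<^bsup>i-1\<^esup>y\<close> that follows the first \<open>y\<close> shows.\<close>

section \<open>Periodic sequences and their orbits under the shift\<close>

text \<open>Cyclic words of length \<open>m\<close> are encoded as \<open>m\<close>-periodic
  sequences: rotation becomes translation of the index, and a word fixed by a rotation is just a
  sequence with a further period.\<close>

definition shift :: "nat \<Rightarrow> (nat \<Rightarrow> 'a) \<Rightarrow> nat \<Rightarrow> 'a" where
  "shift r f = (\<lambda>i. f (r + i))"

definition periodic :: "nat \<Rightarrow> (nat \<Rightarrow> 'a) set" where
  "periodic m = {f. \<forall>i. f (i + m) = f i}"

definition pext :: "'a list \<Rightarrow> nat \<Rightarrow> 'a" where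
  "pext w = (\<lambda>i. w ! (i mod length w))"

text \<open>The run is sought in the infinite sequence, so it may wrap around and even exceed the
  period. The condition thus does not depend on the chosen period, as the use of Burnside's lemma
  requires.\<close>

definition has_run :: "nat \<Rightarrow> 'a \<Rightarrow> (nat \<Rightarrow> 'a) \<Rightarrow> bool" where
  "has_run n a f \<longleftrightarrow> (\<exists>s. \<forall>i<n. f (s + i) = a)"

definition orb :: "(nat \<Rightarrow> 'a) \<Rightarrow> (nat \<Rightarrow> 'a) set" where
  "orb f = range (\<lambda>r. shift r f)"

lemma shift_0 [simp]: "shift 0 f = f"
  by (simp add: shift_def)

lemma shift_shift: "shift r (shift s f) = shift (r + s) f"
  by (simp add: shift_def add_ac)

lemma periodic_add: "f \<in> periodic m \<Longrightarrow> f (i + m) = f i"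
  by (simp add: periodic_def)

lemma periodic_add_mult: "f \<in> periodic m \<Longrightarrow> f (i + q * m) = f i"
proof (induction q)
  case (Suc q)
  then show ?case using periodic_add[of f m "i + q * m"] by (simp add: add_ac)
qed simp

lemma periodic_mod: "f \<in> periodic m \<Longrightarrow> f (i mod m) = f i"
  using periodic_add_mult[of f m "i mod m" "i div m"] by simp

lemma periodic_eqI:
  assumes "f \<in> periodic m" "g \<in> periodic m" "m > 0" "\<And>i. i < m \<Longrightarrow> f i = g i"
  shows "f = g"
proof
  fix i
  show "f i = g i"
    using assms(4)[of "i mod m"] assms(3) by (simp add: periodic_mod assms(1,2))
qed

lemma periodic_iff_shift: "f \<in> periodic m \<longleftrightarrow> shift m f = f"
  by (auto simp: periodic_def shift_def fun_eq_iff add_ac)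

lemma shift_periodic: "f \<in> periodic m \<Longrightarrow> shift r f \<in> periodic m"
  by (simp add: periodic_iff_shift shift_shift) (metis add.commute shift_shift)

lemma shift_mult_period: "f \<in> periodic m \<Longrightarrow> shift (q * m) f = f"
  by (auto simp: shift_def fun_eq_iff periodic_add_mult add.commute)

text \<open>By Bezout, a step by \<open>gcd r m\<close> followed by \<open>y\<close> steps by
  \<open>m\<close> amounts to \<open>x\<close> steps by \<open>r\<close>.\<close>

lemma periodic_gcd: "f \<in> periodic r \<and> f \<in> periodic m \<longleftrightarrow> f \<in> periodic (gcd r m)"
proof (intro iffI conjI)
  assume *: "f \<in> periodic r \<and> f \<in> periodic m"
  show "f \<in> periodic (gcd r m)"
  proof (cases "r = 0")
    case False
    then obtain x y where xy: "r * x = m * y + gcd r m"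
      using bezout_nat by blast
    have "f (i + gcd r m) = f i" for i
    proof -
      have "f (i + gcd r m) = f ((i + gcd r m) + y * m)"
        using * periodic_add_mult by metis
      also have "\<dots> = f (i + x * r)"
        using xy by (simp add: algebra_simps)
      finally show ?thesis using * periodic_add_mult by metis
    qed
    then show ?thesis by (simp add: periodic_def)
  qed (use * in simp)
next
  assume *: "f \<in> periodic (gcd r m)"
  show "f \<in> periodic r" "f \<in> periodic m"
    using periodic_add_mult[OF *, of _ "r div gcd r m"] periodic_add_mult[OF *, of _ "m div gcd r m"]
    by (simp_all add: periodic_def)
qed

section \<open>Periodic extension of finite words\<close>

lemma pext_nth: "i < length w \<Longrightarrow> pext w i = w ! i"
  by (simp add: pext_def)

lemma pext_periodic: "pext w \<in> periodic (length w)"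
  by (simp add: pext_def periodic_def)

lemma pext_eq_iff:
  assumes "length u = length v"
  shows "pext u = pext v \<longleftrightarrow> u = v"
  using assms by (metis nth_equalityI pext_nth)

lemma pext_map_upt: "f \<in> periodic m \<Longrightarrow> m > 0 \<Longrightarrow> pext (map f [0..<m]) = f"
  by (rule periodic_eqI[of _ m]) (use pext_periodic[of "map f [0..<m]"] in \<open>auto simp: pext_nth\<close>)

lemma bij_betw_pext: "m > 0 \<Longrightarrow> bij_betw pext {w. length w = m} (periodic m)"
proof (rule bij_betwI')
  show "\<exists>w\<in>{w. length w = m}. f = pext w" if "f \<in> periodic m" "m > 0" for f :: "nat \<Rightarrow> 'a"
    using that by (intro bexI[of _ "map f [0..<m]"]) (simp_all add: pext_map_upt)
qed (use pext_periodic in \<open>auto simp: pext_eq_iff\<close>)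

lemma UNIV_letter: "(UNIV :: letter set) = {Lx, Ly}"
  by (auto intro: letter.exhaust)

instance letter :: finite
  by standard (unfold UNIV_letter, simp)

lemma card_letter: "card (UNIV :: letter set) = 2"
  unfolding UNIV_letter by simp

lemma finite_periodic: "m > 0 \<Longrightarrow> finite (periodic m :: (nat \<Rightarrow> 'a :: finite) set)"
  using bij_betw_finite[OF bij_betw_pext[where ?'a = 'a], of m] finite_lists_length_eq[of "UNIV :: 'a set" m]
  by simp

lemma card_periodic_letter: "m > 0 \<Longrightarrow> card (periodic m :: (nat \<Rightarrow> letter) set) = 2 ^ m"
  using bij_betw_same_card[OF bij_betw_pext[where ?'a = letter], of m] card_lists_length_eq[of "UNIV :: letter set" m]
  by (simp add: card_letter)

section \<open>Orbits and Burnside's lemma\<close>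

lemma orb_self: "f \<in> orb f"
  unfolding orb_def by (rule range_eqI[of _ _ 0]) simp

lemma orb_shift:
  assumes "f \<in> periodic N" "N > 0"
  shows "orb (shift s f) = orb f"
proof
  show "orb (shift s f) \<subseteq> orb f" by (auto simp: orb_def shift_shift)
  \<comment> \<open>Shifts only move forward, so the shift by \<open>s\<close> is undone by going on
    to \<open>s * N\<close>, a multiple of the period.\<close>
  have "shift r f = shift (r + (s * N - s)) (shift s f)" for r
  proof -
    have "shift r f = shift r (shift (s * N) f)"
      using shift_mult_period[OF assms(1)] by simp
    moreover have "r + s * N = r + (s * N - s) + s" using assms(2) by (cases N) auto
    ultimately show ?thesis by (simp only: shift_shift)
  qed
  then show "orb f \<subseteq> orb (shift s f)" unfolding orb_def by blast
qed

lemma orb_eq_iff: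
  assumes "f \<in> periodic N" "N > 0"
  shows "orb f = orb g \<longleftrightarrow> g \<in> orb f"
  using orb_shift[OF assms] orb_self[of g] by (auto simp: orb_def)

text \<open>The shifts by \<open>1, ..., N\<close> form one full period. Moving the start by one
  trades the shift by \<open>1\<close> for the one by \<open>N + 1\<close>, which has the same
  value.\<close>

lemma sum_shifts_shift:
  fixes h :: "(nat \<Rightarrow> 'a) \<Rightarrow> 'b :: cancel_comm_monoid_add"
  assumes "f \<in> periodic N"
  shows "(\<Sum>r<N. h (shift (Suc r) (shift s f))) = (\<Sum>r<N. h (shift (Suc r) f))"
proof (induction s)
  case (Suc s)
  define F where "F = shift s f"
  have F: "shift N F = F"
    using shift_periodic[OF assms, of s] by (simp add: F_def periodic_iff_shift)
  let ?h = "\<lambda>r. h (shift (Suc r) F)"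
  have "(\<Sum>r<N. h (shift (Suc r) (shift (Suc s) f))) = (\<Sum>r<N. ?h (Suc r))"
    by (simp add: F_def shift_shift)
  also have "?h 0 + \<dots> = (\<Sum>r<N. ?h r) + ?h N"
    by (rule trans[OF sum.lessThan_Suc_shift[symmetric] sum.lessThan_Suc])
  moreover have "?h N = ?h 0"
    using shift_shift[of 1 N F] by (simp add: F)
  ultimately show ?case using Suc by (simp add: F_def add.commute)
qed simp

text \<open>For \<open>N\<close>-periodic \<open>f\<close> and \<open>g = f\<close> this is the
  order of the stabiliser of \<open>f\<close> under rotation; in general it is, up to sign, a
  coefficient of \<open>rho\<close> (see \<open>coeff_rho\<close>).\<close>

definition cnt :: "nat \<Rightarrow> (nat \<Rightarrow> 'a) \<Rightarrow> (nat \<Rightarrow> 'a) \<Rightarrow> nat" where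
  "cnt N f g = (\<Sum>r<N. if shift (Suc r) f = g then 1 else 0)"

lemma cnt_shift: "f \<in> periodic N \<Longrightarrow> cnt N (shift s f) g = cnt N f g"
  unfolding cnt_def by (rule sum_shifts_shift)

lemma cnt_pos_iff:
  assumes "f \<in> periodic N" "N > 0"
  shows "cnt N f g \<noteq> 0 \<longleftrightarrow> g \<in> orb f"
proof
  assume "cnt N f g \<noteq> 0"
  then show "g \<in> orb f" by (auto simp: cnt_def orb_def split: if_splits)
next
  assume "g \<in> orb f"
  then obtain r where r: "g = shift r f" by (auto simp: orb_def)
  have "cnt N f g = cnt N g g" unfolding r by (rule cnt_shift[OF assms(1), symmetric])
  moreover have "shift (Suc (N - 1)) g = g"
    using assms shift_periodic[OF assms(1), of r] by (simp add: r periodic_iff_shift)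
  ultimately show "cnt N f g \<noteq> 0" using assms(2)
    by (auto simp: cnt_def simp del: Suc_pred Suc_diff_1 intro!: bexI[of _ "N - 1"])
qed

text \<open>The pairs of a shift \<open>r\<close> and a sequence fixed by it are counted in two
  ways; each orbit accounts for \<open>N\<close> of them.\<close>

lemma burnside_shift:
  fixes X :: "(nat \<Rightarrow> 'a :: finite) set"
  assumes "N > 0" "X \<subseteq> periodic N" and shift: "\<And>f r. f \<in> X \<Longrightarrow> shift r f \<in> X"
  shows "N * card (orb ` X) = (\<Sum>r\<in>{0<..N}. card {f \<in> X. shift r f = f})"
proof -
  have fin: "finite X" using assms(1,2) finite_periodic finite_subset by blast
  have "(\<Sum>r\<in>{0<..N}. card {f \<in> X. shift r f = f}) = (\<Sum>r<N. card {f \<in> X. shift (Suc r) f = f})"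
    by (rule sum.reindex_bij_witness[of _ Suc "\<lambda>r. r - 1"]) auto
  also have "\<dots> = (\<Sum>r<N. \<Sum>f\<in>X. if shift (Suc r) f = f then 1 else 0)"
    using fin by (simp add: sum.If_cases Int_def)
  also have "\<dots> = (\<Sum>f\<in>X. cnt N f f)"
    unfolding cnt_def by (rule sum.swap)
  also have "\<dots> = (\<Sum>Q\<in>orb ` X. \<Sum>f\<in>{f \<in> X. orb f = Q}. cnt N f f)"
    by (rule sum.image_gen[OF fin])
  also have "\<dots> = (\<Sum>Q\<in>orb ` X. N)"
  proof (rule sum.cong[OF refl])
    fix Q assume "Q \<in> orb ` X"
    then obtain g where g: "g \<in> X" "Q = orb g" by auto
    have gN: "g \<in> periodic N" using g assms by auto
    have "orb f = Q \<longleftrightarrow> f \<in> Q" for f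
      using orb_eq_iff[OF gN assms(1), of f] g by auto
    moreover have "Q \<subseteq> X"
      using g shift by (auto simp: orb_def)
    then have "finite Q" using fin finite_subset by blast
    moreover note \<open>Q \<subseteq> X\<close>
    ultimately have Q: "{f \<in> X. orb f = Q} = Q" by auto
    \<comment> \<open>On the orbit of \<open>g\<close>, \<open>cnt N f f\<close> may be replaced by
      \<open>cnt N g f\<close>, and each of the \<open>N\<close> shifts of \<open>g\<close> hits
      exactly one element of \<open>Q\<close>.\<close>
    have "(\<Sum>f\<in>{f \<in> X. orb f = Q}. cnt N f f) = (\<Sum>f\<in>Q. cnt N g f)"
      unfolding Q
    proof (rule sum.cong[OF refl])
      fix f assume "f \<in> Q"
      then show "cnt N f f = cnt N g f" using cnt_shift[OF gN] by (auto simp: g orb_def)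
    qed
    also have "\<dots> = (\<Sum>r<N. \<Sum>f\<in>Q. if shift (Suc r) g = f then 1 else 0)"
      unfolding cnt_def by (rule sum.swap)
    also have "\<dots> = (\<Sum>r<N. 1)"
      using \<open>finite Q\<close> by (intro sum.cong) (auto simp: g(2) orb_def)
    finally show "(\<Sum>f\<in>{f \<in> X. orb f = Q}. cnt N f f) = N" by simp
  qed
  finally show ?thesis by simp
qed

lemma sum_gcd_totient:
  fixes h :: "nat \<Rightarrow> 'a :: comm_semiring_1"
  assumes "N > 0"
  shows "(\<Sum>r\<in>{0<..N}. h (gcd r N)) = (\<Sum>d | d dvd N. of_nat (totient (N div d)) * h d)"
proof -
  have "(\<Sum>r\<in>{0<..N}. h (gcd r N)) = (\<Sum>d | d dvd N. \<Sum>r | r \<in> {0<..N} \<and> gcd r N = d. h (gcd r N))"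
    by (rule sum.group[symmetric]) (use assms in auto)
  also have "\<dots> = (\<Sum>d | d dvd N. of_nat (totient (N div d)) * h d)"
  proof (rule sum.cong[OF refl])
    fix d assume "d \<in> {d. d dvd N}"
    then have "card {r \<in> {0<..N}. gcd r N = d} = totient (N div d)"
      using assms by (intro card_gcd_eq_totient) auto
    then show "(\<Sum>r | r \<in> {0<..N} \<and> gcd r N = d. h (gcd r N)) = of_nat (totient (N div d)) * h d"
      by simp
  qed
  finally show ?thesis .
qed

section \<open>Periodic sequences without long runs\<close>

definition norun :: "nat \<Rightarrow> word \<Rightarrow> bool" where
  "norun n w \<longleftrightarrow> \<not> (\<exists>t. t + n \<le> length w \<and> (\<forall>i<n. w ! (t + i) = Lx))"

text \<open>A nonempty window of letters \<open>Lx\<close> cannot cover the separating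
  \<open>Ly\<close>, so it lies on one side of it.\<close>

lemma norun_append:
  assumes "n > 0"
  shows "norun n (u @ Ly # v) \<longleftrightarrow> norun n u \<and> norun n v"
proof -
  let ?w = "u @ Ly # v"
  have "(\<exists>t. t + n \<le> length ?w \<and> (\<forall>i<n. ?w ! (t + i) = Lx)) \<longleftrightarrow>
    (\<exists>t. t + n \<le> length u \<and> (\<forall>i<n. u ! (t + i) = Lx)) \<or>
    (\<exists>t. t + n \<le> length v \<and> (\<forall>i<n. v ! (t + i) = Lx))" (is "?L \<longleftrightarrow> ?A \<or> ?B")
  proof (intro iffI; elim disjE exE conjE)
    fix t assume t: "t + n \<le> length ?w" "\<forall>i<n. ?w ! (t + i) = Lx"
    have "t + n \<le> length u \<or> length u < t"
    proof (rule ccontr)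
      assume *: "\<not> ?thesis"
      then have "?w ! (t + (length u - t)) = Lx" by (intro t(2)[rule_format]) auto
      then show False using * by simp
    qed
    then show "?A \<or> ?B"
    proof
      assume "t + n \<le> length u"
      then have ?A using t by (intro exI[of _ t]) (auto simp: nth_append)
      then show ?thesis ..
    next
      assume l: "length u < t"
      have "v ! (t - Suc (length u) + i) = Lx" if "i < n" for i
        using t(2)[rule_format, OF that] l by (simp add: nth_append nth_Cons' Suc_diff_Suc)
      then have ?B using t(1) l by (intro exI[of _ "t - Suc (length u)"]) auto
      then show ?thesis ..
    qed
  next
    fix t assume "t + n \<le> length u" "\<forall>i<n. u ! (t + i) = Lx"
    then show ?L by (intro exI[of _ t]) (auto simp: nth_append)
  next
    fix t assume "t + n \<le> length v" "\<forall>i<n. v ! (t + i) = Lx"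
    then show ?L by (intro exI[of _ "Suc (length u) + t"]) (auto simp: nth_append)
  qed
  then show ?thesis by (auto simp: norun_def)
qed

lemma norun_replicate: "norun n (replicate p Lx) \<longleftrightarrow> p < n"
proof
  assume "norun n (replicate p Lx)"
  then show "p < n" by (rule contrapos_pp) (auto simp: norun_def intro: exI[of _ 0])
qed (auto simp: norun_def)

lemma norun_short: "length w < n \<Longrightarrow> norun n w"
  by (auto simp: norun_def)

lemma no_Ly_replicate: "Ly \<notin> set w \<Longrightarrow> w = replicate (length w) Lx"
  by (metis (full_types) letter.exhaust replicate_eqI)

lemma first_Ly:
  assumes "Ly \<in> set w"
  obtains p v where "w = replicate p Lx @ Ly # v"
  using split_list_first[OF assms] no_Ly_replicate by metis

lemma replicate_Ly_inject:
  "replicate p Lx @ Ly # v = replicate q Lx @ Ly # u \<longleftrightarrow> p = q \<and> v = u"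
proof (induction p arbitrary: q)
  case 0 then show ?case by (cases q) auto
next
  case (Suc p) then show ?case by (cases q) auto
qed

text \<open>The pair \<open>(p, v)\<close> stands for the word \<open>Lx\<^sup>p Ly v\<close>, read cyclically: its runs of \<open>Lx\<close> are those of
  \<open>v Lx\<^sup>p\<close>.\<close>

definition cyc :: "nat \<Rightarrow> nat \<Rightarrow> (nat \<times> word) set" where
  "cyc n m = {(p, v). Suc (p + length v) = m \<and> norun n (v @ replicate p Lx)}"

lemma finite_cyc: "finite (cyc n m)"
proof (rule finite_subset)
  show "cyc n m \<subseteq> {..m} \<times> {w. set w \<subseteq> UNIV \<and> length w \<le> m}" by (auto simp: cyc_def)
qed (intro finite_cartesian_product finite_lists_length_le; simp)

text \<open>The Lucas recursion arises by deleting the first block of \<open>v\<close>, up to and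
  including its first \<open>Ly\<close>. The length \<open>i\<close> of the block is at most
  \<open>n\<close>, since its run has length \<open>i - 1 < n\<close>.\<close>

lemma cyc_rec:
  assumes "0 < n" "n < m"
  shows "card (cyc n m) = (\<Sum>i=1..n. card (cyc n (m - i)))"
proof -
  define ins where "ins = (\<lambda>i (p :: nat, v). (p, replicate (i - 1) Lx @ Ly # v))"
  have norun: "norun n ((replicate (i - 1) Lx @ Ly # v) @ replicate p Lx) \<longleftrightarrow>
      i \<le> n \<and> norun n (v @ replicate p Lx)" if "i > 0" for i p v
    using that assms(1) norun_append[of n "replicate (i - 1) Lx" "v @ replicate p Lx"]
    by (auto simp: norun_replicate)
  have "cyc n m = (\<Union>i\<in>{1..n}. ins i ` cyc n (m - i))"
  proof (intro equalityI subsetI)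
    fix c assume "c \<in> cyc n m"
    then obtain p v where c: "c = (p, v)" "Suc (p + length v) = m" "norun n (v @ replicate p Lx)"
      by (auto simp: cyc_def)
    \<comment> \<open>Otherwise \<open>v @ replicate p Lx\<close> is a run of length
      \<open>m - 1\<close>, which is at least \<open>n\<close>.\<close>
    have "Ly \<in> set v"
    proof (rule ccontr)
      assume "Ly \<notin> set v"
      then have "v @ replicate p Lx = replicate (length v + p) Lx"
        using no_Ly_replicate by (metis replicate_add)
      then show False using c assms by (simp add: norun_replicate)
    qed
    then obtain j u where v: "v = replicate j Lx @ Ly # u" by (rule first_Ly)
    have "Suc j \<le> n" "(p, u) \<in> cyc n (m - Suc j)"
      using c norun[of "Suc j" u p] by (auto simp: v cyc_def)
    then show "c \<in> (\<Union>i\<in>{1..n}. ins i ` cyc n (m - i))"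
      by (intro UN_I[of "Suc j"]) (auto simp: ins_def c v)
  next
    fix c assume "c \<in> (\<Union>i\<in>{1..n}. ins i ` cyc n (m - i))"
    then obtain i p v where "1 \<le> i" "i \<le> n" "(p, v) \<in> cyc n (m - i)" "c = ins i (p, v)"
      by auto
    then show "c \<in> cyc n m"
      using norun[of i v p] by (auto simp: cyc_def ins_def)
  qed
  also have "card \<dots> = (\<Sum>i\<in>{1..n}. card (ins i ` cyc n (m - i)))"
    by (rule card_UN_disjoint) (auto simp: finite_cyc ins_def replicate_Ly_inject)
  also have "\<dots> = (\<Sum>i=1..n. card (cyc n (m - i)))"
    by (intro sum.cong refl card_image) (auto simp: inj_on_def ins_def)
  finally show ?thesis .
qed

text \<open>A word other than a power of \<open>Lx\<close> is cut at its first \<open>Ly\<close>;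
  the second assumption keeps that power out of the target set.\<close>

lemma bij_betw_cyc:
  assumes "\<And>p v. Suc (p + length v) = m \<Longrightarrow> P p v \<longleftrightarrow> Q (replicate p Lx @ Ly # v)"
    and "\<not> Q (replicate m Lx)"
  shows "bij_betw (\<lambda>(p, v). replicate p Lx @ Ly # v)
    {(p, v). Suc (p + length v) = m \<and> P p v} {w. length w = m \<and> Q w}"
proof (rule bij_betwI')
  fix w assume "w \<in> {w. length w = m \<and> Q w}"
  then have w: "length w = m" "Q w" by auto
  then have "Ly \<in> set w" using assms(2) no_Ly_replicate by metis
  then obtain p v where "w = replicate p Lx @ Ly # v" by (rule first_Ly)
  then show "\<exists>c\<in>{(p, v). Suc (p + length v) = m \<and> P p v}. w = (\<lambda>(p, v). replicate p Lx @ Ly # v) c"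
    using w assms(1)[of p v] by auto
next
  fix c assume "c \<in> {(p, v). Suc (p + length v) = m \<and> P p v}"
  then obtain p v where "c = (p, v)" "Suc (p + length v) = m" "P p v" by auto
  with assms(1)[of p v]
  show "(\<lambda>(p, v). replicate p Lx @ Ly # v) c \<in> {w. length w = m \<and> Q w}" by simp
qed (simp add: replicate_Ly_inject case_prod_beta prod_eq_iff)

text \<open>\<open>v @ replicate p Lx\<close> has only \<open>m - 1 < n\<close> letters, so no run
  can occur and all words except the power of \<open>Lx\<close> are counted.\<close>

lemma card_cyc_short:
  assumes "0 < m" "m \<le> n"
  shows "card (cyc n m) = 2 ^ m - 1"
proof -
  have "bij_betw (\<lambda>(p, v). replicate p Lx @ Ly # v) (cyc n m) {w. length w = m \<and> w \<noteq> replicate m Lx}"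
    unfolding cyc_def
  proof (rule bij_betw_cyc)
    fix p and v :: word assume "Suc (p + length v) = m"
    moreover have "replicate p Lx @ Ly # v \<noteq> replicate m Lx"
      by (metis in_set_conv_decomp in_set_replicate letter.distinct(1))
    ultimately show "norun n (v @ replicate p Lx) \<longleftrightarrow> replicate p Lx @ Ly # v \<noteq> replicate m Lx"
      using assms by (simp add: norun_short)
  qed simp
  then have "card (cyc n m) = card ({w :: word. set w \<subseteq> UNIV \<and> length w = m} - {replicate m Lx})"
    by (simp add: bij_betw_same_card set_diff_eq)
  then show ?thesis
    using card_lists_length_eq[of "UNIV :: letter set" m] by (simp add: card_letter)
qed

text \<open>Read from just behind the \<open>Ly\<close> at position \<open>p\<close>, the cyclic
  word is \<open>v @ replicate p Lx\<close> followed by that \<open>Ly\<close> again, and no run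
  passes a \<open>Ly\<close>.\<close>

lemma has_run_pext:
  assumes "n > 0" and m: "Suc (p + length v) = m"
  shows "has_run n Lx (pext (replicate p Lx @ Ly # v)) \<longleftrightarrow> \<not> norun n (v @ replicate p Lx)"
proof -
  let ?w = "replicate p Lx @ Ly # v" and ?u = "v @ replicate p Lx"
  define f where "f = pext ?w"
  have f: "f \<in> periodic m" using pext_periodic[of ?w] m by (simp add: f_def)
  have fp: "f p = Ly" by (simp add: f_def pext_nth nth_append)
  have u: "?u ! i = f (Suc p + i)" if "i < m - 1" for i
  proof (cases "i < length v")
    case True
    then show ?thesis using m by (simp add: f_def pext_nth nth_append)
  next
    case False
    then have "Suc p + i = (i - length v) + m" using m by linarith
    then have "f (Suc p + i) = f (i - length v)" by (simp only: periodic_add[OF f])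
    then show ?thesis using False that m by (simp add: f_def pext_nth nth_append)
  qed
  have len: "length ?u = m - 1" using m by simp
  have "has_run n Lx f \<longleftrightarrow> \<not> norun n ?u"
  proof
    assume "\<not> norun n ?u"
    then obtain t where t: "t + n \<le> m - 1" "\<And>i. i < n \<Longrightarrow> ?u ! (t + i) = Lx"
      unfolding norun_def len by blast
    have "f (Suc p + t + i) = Lx" if "i < n" for i
      using t(1) t(2)[OF that] u[of "t + i"] that by (simp add: add.assoc)
    then show "has_run n Lx f" unfolding has_run_def by blast
  next
    assume "has_run n Lx f"
    then obtain s where s: "\<And>i. i < n \<Longrightarrow> f (s + i) = Lx" by (auto simp: has_run_def)
    \<comment> \<open>The start \<open>s\<close> of the run, measured from position
      \<open>Suc p\<close> modulo the period; adding \<open>m\<close> keeps the subtraction from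
      truncating.\<close>
    define t where "t = (s + m - Suc p) mod m"
    have t: "t < m" using m by (simp add: t_def)
    have ft: "f (Suc p + t + i) = Lx" if "i < n" for i
    proof -
      have "f (Suc p + t + i) = f (Suc p + t + i + ((s + m - Suc p) div m) * m)"
        by (simp only: periodic_add_mult[OF f])
      also have "Suc p + t + i + ((s + m - Suc p) div m) * m = s + i + m"
        using m mod_div_mult_eq[of "s + m - Suc p" m] unfolding t_def by linarith
      finally show ?thesis using s[OF that] by (simp only: periodic_add[OF f])
    qed
    \<comment> \<open>Otherwise the run would cover position \<open>p + m\<close>, which carries
      \<open>Ly\<close>.\<close>
    have "t + n \<le> m - 1"
    proof (rule ccontr)
      assume "\<not> t + n \<le> m - 1"
      then have "f (Suc p + t + (m - 1 - t)) = Lx" using t by (intro ft) linarith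
      moreover have "Suc p + t + (m - 1 - t) = p + m" using t by simp
      ultimately show False using fp by (simp add: periodic_add[OF f])
    qed
    then show "\<not> norun n ?u"
      using ft assms(1) u unfolding norun_def len not_not
      by (intro exI[of _ t]) (simp add: add.assoc)
  qed
  then show ?thesis by (simp add: f_def)
qed

lemma has_run_const: "has_run n Lx (pext (replicate m Lx))" if "m > 0"
  using that by (auto simp: has_run_def pext_def)

lemma card_no_run:
  assumes "0 < n" "0 < m"
  shows "card {f \<in> periodic m. \<not> has_run n Lx f} = card (cyc n m)"
proof -
  have "bij_betw (\<lambda>(p, v). replicate p Lx @ Ly # v) (cyc n m)
      {w. length w = m \<and> \<not> has_run n Lx (pext w)}"
    unfolding cyc_def
    by (rule bij_betw_cyc) (use assms in \<open>auto simp: has_run_pext has_run_const\<close>)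
  moreover have "bij_betw pext {w \<in> {w. length w = m}. \<not> has_run n Lx (pext w)}
      {f \<in> periodic m. \<not> has_run n Lx f}"
    using bij_betw_pext[OF assms(2)] unfolding bij_betw_def by (auto intro: inj_on_subset)
  ultimately show ?thesis
    by (metis (no_types, lifting) Collect_cong bij_betw_same_card mem_Collect_eq)
qed

lemma card_cyc: "0 < n \<Longrightarrow> 0 < m \<Longrightarrow> int (card (cyc n m)) = lucas n m"
proof (induction m rule: less_induct)
  case (less m)
  show ?case
  proof (cases "m \<le> n")
    case True
    then show ?thesis using less by (simp add: lucas.simps[of n m] card_cyc_short of_nat_diff)
  next
    case False
    then have "int (card (cyc n m)) = (\<Sum>i=1..n. int (card (cyc n (m - i))))"
      using less.prems by (simp add: cyc_rec)
    also have "\<dots> = (\<Sum>i=1..n. lucas n (m - i))"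
      using False by (intro sum.cong refl less) auto
    finally show ?thesis using False less.prems by (simp add: lucas.simps[of n m])
  qed
qed

lemma card_has_run:
  assumes "0 < m"
  shows "int (card {f \<in> periodic m. has_run n Lx f}) = 2 ^ m - lucas n m"
proof -
  let ?G = "{f \<in> periodic m. \<not> has_run n Lx f}"
  have "int (card ?G) = lucas n m"
  \<comment> \<open>For \<open>n = 0\<close> the empty run occurs in every sequence, which matches
    the convention \<open>lucas 0 m = 0\<close>.\<close>
  proof (cases "n = 0")
    case True
    then show ?thesis by (simp add: has_run_def lucas.simps)
  next
    case False
    then show ?thesis using assms by (simp add: card_no_run card_cyc)
  qed
  moreover have "card {f \<in> periodic m. has_run n Lx f} + card ?G = card (periodic m :: (nat \<Rightarrow> letter) set)"
    using assms by (subst card_Un_disjoint[symmetric]) (auto intro!: arg_cong[of _ _ card] simp: finite_periodic)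
  then have "int (card {f \<in> periodic m. has_run n Lx f}) + int (card ?G) = 2 ^ m"
    using card_periodic_letter[OF assms] by (simp flip: of_nat_add)
  ultimately show ?thesis by linarith
qed

section \<open>Counting necklaces with a long run\<close>

lemma has_run_shift:
  assumes "f \<in> periodic N" "N > 0" "has_run n a f"
  shows "has_run n a (shift r f)"
proof -
  obtain s where s: "\<And>i. i < n \<Longrightarrow> f (s + i) = a" using assms(3) by (auto simp: has_run_def)
  have "shift r f (s + (r * N - r) + i) = a" if "i < n" for i
  proof -
    have "r + (s + (r * N - r) + i) = (s + i) + r * N"
      using assms(2) by (cases N) (simp_all add: algebra_simps)
    then have "shift r f (s + (r * N - r) + i) = f ((s + i) + r * N)"
      unfolding shift_def by (rule arg_cong)
    then show ?thesis using s[OF that] by (simp only: periodic_add_mult[OF assms(1)])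
  qed
  then show ?thesis by (auto simp: has_run_def)
qed

text \<open>Among the \<open>N\<close>-periodic sequences, those fixed by \<open>shift r\<close> are
  the ones of period \<open>gcd r N\<close>; the \<open>r\<close> with a given gcd are counted by
  the totient.\<close>

lemma card_necklaces:
  assumes "N > 0"
  shows "int N * int (card (orb ` {f \<in> periodic N. has_run n Lx f})) =
    (\<Sum>m | m dvd N. int (totient (N div m)) * (2 ^ m - lucas n m))"
proof -
  let ?X = "{f \<in> periodic N. has_run n Lx f}"
  have "N * card (orb ` ?X) = (\<Sum>r\<in>{0<..N}. card {f \<in> ?X. shift r f = f})"
    by (rule burnside_shift) (use assms in \<open>auto simp: shift_periodic has_run_shift\<close>)
  also have "\<dots> = (\<Sum>r\<in>{0<..N}. card {f \<in> periodic (gcd r N). has_run n Lx f})"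
  proof (intro sum.cong refl arg_cong[of _ _ card])
    fix r
    show "{f \<in> ?X. shift r f = f} = {f \<in> periodic (gcd r N). has_run n Lx f}"
      by (auto simp: periodic_iff_shift[symmetric] periodic_gcd[symmetric])
  qed
  finally have "int N * int (card (orb ` ?X)) = (\<Sum>r\<in>{0<..N}. 2 ^ gcd r N - lucas n (gcd r N))"
    by (simp add: card_has_run assms flip: of_nat_mult)
  then show ?thesis by (simp add: sum_gcd_totient[OF assms, of "\<lambda>m. 2 ^ m - lucas n m"])
qed

section \<open>Linear algebra in free vector spaces\<close>


lemma linext_uminus: "linext f (- p) = - linext f p"
  using linext_scale[of f "-1" p] by simp

lemma linext_diff: "linext f (p - q) = linext f p - linext f q"
  using linext_add[of f p "- q"] by (simp add: linext_uminus)

lemma linext_sum: "linext f (sum g A) = (\<Sum>i\<in>A. linext f (g i))"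
  by (induction A rule: infinite_finite_induct) (simp_all add: linext_add)

lemma linext_mon [simp]: "linext f (mon w) = f w"
  by (simp add: mon_def)

lemma linext_mult:
  fixes f :: "'a :: monoid_add \<Rightarrow> ('b :: monoid_add \<Rightarrow>\<^sub>0 rat)"
  assumes "\<And>u v. f (u + v) = f u * f v"
  shows "linext f (p * q) = linext f p * linext f q"
proof (induction p rule: poly_mapping_induct_single)
  case (2 a c p)
  have "linext f (Poly_Mapping.single a c * q) = scale c (f a) * linext f q"
    by (induction q rule: poly_mapping_induct_single)
      (simp_all add: distrib_left linext_add mult_single assms scale_mult_left scale_mult_right)
  with 2 show ?case by (simp add: distrib_right linext_add)
qed simp

lemma mon_Nil: "mon [] = 1"
  by (simp add: one_eq_mon)

lemma mon_Cons: "mon (a # w) = mon [a] * mon w"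
  using mon_append[of "[a]" w] by simp

lemma mon_replicate: "mon (replicate m a) = mon [a] ^ m"
  by (induction m) (simp_all add: mon_Nil mon_Cons[of a "replicate _ _"])

lemma span_image_times_left:
  assumes "p \<in> pm.span (f ` A)" "\<And>a. a \<in> A \<Longrightarrow> q * f a \<in> pm.span T"
  shows "q * (p :: H) \<in> pm.span T"
  using assms(1)
proof (induction rule: pm.span_induct_alt)
  case (step c x y)
  then show ?case
    using assms(2) by (auto simp: distrib_left scale_mult_right intro!: pm.span_add pm.span_scale)
qed (simp add: pm.span_zero)

lemma span_image_times_right:
  assumes "p \<in> pm.span (f ` A)" "\<And>a. a \<in> A \<Longrightarrow> f a * q \<in> pm.span T"
  shows "(p :: H) * q \<in> pm.span T"
  using assms(1)
proof (induction rule: pm.span_induct_alt)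
  case (step c x y)
  then show ?case
    using assms(2) by (auto simp: distrib_right scale_mult_left intro!: pm.span_add pm.span_scale)
qed (simp add: pm.span_zero)

text \<open>Applied to a vanishing combination, \<open>l j\<close> isolates the coefficient of
  \<open>v j\<close>.\<close>

lemma independent_by_functionals:
  fixes v :: "'i \<Rightarrow> ('a \<Rightarrow>\<^sub>0 rat)" and l :: "'i \<Rightarrow> ('a \<Rightarrow>\<^sub>0 rat) \<Rightarrow> rat"
  assumes fin: "finite I"
    and add: "\<And>i p q. l i (p + q) = l i p + l i q"
    and scale: "\<And>i c p. l i (scale c p) = c * l i p"
    and diag: "\<And>i. i \<in> I \<Longrightarrow> l i (v i) \<noteq> 0"
    and off_diag: "\<And>i j. i \<in> I \<Longrightarrow> j \<in> I \<Longrightarrow> i \<noteq> j \<Longrightarrow> l j (v i) = 0"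
  shows "inj_on v I" "pm.independent (v ` I)"
proof -
  show inj: "inj_on v I"
    by (rule inj_onI) (metis diag off_diag)
  have zero: "l j 0 = 0" for j using scale[of j 0 0] by simp
  have sum: "l j (sum g A) = (\<Sum>i\<in>A. l j (g i))" for j g and A :: "'i set"
    by (induction A rule: infinite_finite_induct) (simp_all add: zero add)
  have "u (v j) = 0" if "(\<Sum>x\<in>v ` I. scale (u x) x) = 0" "j \<in> I" for u j
  proof -
    have "0 = l j (\<Sum>i\<in>I. scale (u (v i)) (v i))"
      using that(1) by (simp add: sum.reindex[OF inj] zero)
    also have "\<dots> = (\<Sum>i\<in>I. if i = j then u (v j) * l j (v j) else 0)"
      unfolding sum by (rule sum.cong) (use that off_diag in \<open>auto simp: scale\<close>)
    finally show ?thesis using that(2) diag fin by simp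
  qed
  then show "pm.independent (v ` I)"
    using fin by (auto simp: pm.dependent_finite)
qed

section \<open>Words in \<open>z\<close> and \<open>y\<close>\<close>

text \<open>From here on, the letter \<^term>\<open>Lx\<close> in arguments of \<open>zy_mon\<close> stands for \<open>z\<close>, not for \<open>x\<close>.\<close>

fun zy :: "letter \<Rightarrow> H" where
  "zy Lx = hz"
| "zy Ly = hy"

definition zy_mon :: "word \<Rightarrow> H" where
  "zy_mon w = prod_list (map zy w)"

lemma zy_mon_simps [simp]:
  "zy_mon [] = 1" "zy_mon (a # w) = zy a * zy_mon w" "zy_mon (u @ v) = zy_mon u * zy_mon v"
  by (simp_all add: zy_mon_def)

lemma prod_list_replicate_power: "prod_list (replicate n (a :: 'a :: monoid_mult)) = a ^ n"
  by (induction n) simp_all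

lemma zy_mon_replicate: "zy_mon (replicate n a) = zy a ^ n"
  by (simp add: zy_mon_def prod_list_replicate_power)

text \<open>The substitution of \<open>x - y\<close> for \<open>x\<close>. As
  \<open>x = z - y\<close>, it expresses an element in the generators \<open>z\<close> and
  \<open>y\<close>, with \<open>Lx\<close> in the result standing for \<open>z\<close>.\<close>

definition zy_coords :: "H \<Rightarrow> H" where
  "zy_coords = linext (\<lambda>w. prod_list (map (\<lambda>a. if a = Lx then hx - hy else hy) w))"

lemma zy_coords_mult: "zy_coords (p * q) = zy_coords p * zy_coords q"
  unfolding zy_coords_def by (rule linext_mult) (simp add: plus_list_def)

lemma zy_coords_zy_mon: "zy_coords (zy_mon w) = mon w"
proof (induction w)
  case Nil
  then show ?case by (simp add: zy_coords_def one_eq_mon)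
next
  case (Cons a w)
  have "zy_coords (zy a) = mon [a]"
    by (cases a) (simp_all add: zy_coords_def hz_def linext_add hx_def hy_def)
  with Cons show ?case by (simp add: zy_coords_mult mon_Cons[of a w])
qed

text \<open>Removes the outer factors \<open>x\<close> and \<open>y\<close> of the summands of
  \<open>rho n (zy_mon w)\<close>, so that coefficients can be read off.\<close>

definition strip :: "H \<Rightarrow> H" where
  "strip = linext (\<lambda>w. mon (butlast (tl w)))"

lemma strip_hx_hy: "strip (hx * q * hy) = q"
proof (induction q rule: poly_mapping_induct_single)
  case (2 u c q)
  have "strip (hx * Poly_Mapping.single u c * hy) = Poly_Mapping.single u c"
    by (simp add: strip_def hx_def hy_def mon_def mult_single plus_list_def)
  with 2 show ?case by (simp add: strip_def linext_add distrib_left distrib_right)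
qed (simp add: strip_def)

section \<open>The map \<open>\<rho>\<^sub>n\<close> on words in \<open>z\<close> and \<open>y\<close>\<close>

lemma lact_uminus: "lact a (- t) = - lact a t"
  using lact_simps(4)[of a "-1" t] by simp

lemma ract_uminus: "ract (- t) a = - ract t a"
  using ract_simps(4)[of "-1" t a] by simp

lemma lact_sum: "lact a (sum g A) = (\<Sum>i\<in>A. lact a (g i))"
  by (induction A rule: infinite_finite_induct) simp_all

lemma C_map_zy: "C_map n (zy a) = (if a = Ly then - tensor (hx # replicate n hz @ [hy]) else 0)"
  using C_hx[of n] C_hy[of n] by (cases a) (simp_all add: hz_def C_linear)

text \<open>By the Leibniz rule each \<open>Ly\<close> gives one term, while \<open>z\<close> is
  killed. The right action multiplies the letters behind this \<open>Ly\<close> into the first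
  factor, the left action those before it into the last.\<close>

lemma C_map_zy_mon:
  "C_map n (zy_mon w) = - (\<Sum>i<length w. if w ! i = Ly
     then tensor (hx * zy_mon (drop (Suc i) w) # replicate n hz @ [zy_mon (take i w) * hy]) else 0)"
proof (induction w)
  case Nil
  then show ?case by (simp add: C_one)
next
  case (Cons a w)
  have lact: "lact (zy a) (tensor (p # replicate n hz @ [q])) = tensor (p # replicate n hz @ [zy a * q])"
    for p q using lact_tensor[of "zy a" "p # replicate n hz" q] by simp
  have "lact (zy a) (C_map n (zy_mon w)) = - (\<Sum>i<length w. if w ! i = Ly
     then tensor (hx * zy_mon (drop (Suc i) w) # replicate n hz @ [zy_mon (a # take i w) * hy]) else 0)"
    unfolding Cons lact_uminus lact_sum
    by (intro arg_cong[of _ _ uminus] sum.cong refl) (simp add: lact mult.assoc)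
  moreover have "ract (C_map n (zy a)) (zy_mon w) =
      (if a = Ly then - tensor (hx * zy_mon w # replicate n hz @ [hy]) else 0)"
    by (simp add: C_map_zy ract_uminus ract_tensor)
  ultimately show ?case
    by (simp add: C_mult sum.lessThan_Suc_shift del: sum.lessThan_Suc cong: if_cong)
qed

lemma rho_linear:
  "rho n (p + q) = rho n p + rho n q" "rho n (p - q) = rho n p - rho n q"
  "rho n (scale c p) = scale c (rho n p)" "rho n 0 = 0"
  by (simp_all add: rho_def M_map_def C_map_def linext_add linext_diff linext_scale)

text \<open>Multiplying out the tensor puts the letters behind the deleted \<open>y\<close> first,
  then \<open>z^n\<close>, then those before it: the cyclic word \<open>z^n w\<close> cut open at
  this \<open>y\<close>.\<close>

lemma rho_zy_mon:
  "rho n (zy_mon w) = - (\<Sum>i<length w. if w ! i = Ly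
     then hx * zy_mon (drop (Suc i) w @ replicate n Lx @ take i w) * hy else 0)"
proof -
  have "rho n (zy_mon w) = - (\<Sum>i<length w. M_map (if w ! i = Ly
     then tensor (hx * zy_mon (drop (Suc i) w) # replicate n hz @ [zy_mon (take i w) * hy]) else 0))"
    by (simp add: rho_def C_map_zy_mon M_map_def linext_uminus linext_sum)
  also have "\<dots> = - (\<Sum>i<length w. if w ! i = Ly
     then hx * zy_mon (drop (Suc i) w @ replicate n Lx @ take i w) * hy else 0)"
  proof (intro arg_cong[of _ _ uminus] sum.cong refl)
    have "M_map 0 = 0" by (simp add: M_map_def)
    then show "M_map (if w ! i = Ly
        then tensor (hx * zy_mon (drop (Suc i) w) # replicate n hz @ [zy_mon (take i w) * hy]) else 0) =
      (if w ! i = Ly then hx * zy_mon (drop (Suc i) w @ replicate n Lx @ take i w) * hy else 0)" for i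
      by (simp add: M_tensor zy_mon_replicate prod_list_replicate_power mult.assoc)
  qed
  finally show ?thesis .
qed

section \<open>\<open>rho\<close> as a sum over all rotations of a cyclic word\<close>

lemma shift_pext: "r \<le> length w \<Longrightarrow> shift r (pext w) = pext (drop r w @ take r w)"
proof (cases "w = []")
  case False
  assume r: "r \<le> length w"
  let ?w = "drop r w @ take r w"
  have len: "length ?w = length w" using r by simp
  show ?thesis
  proof (rule periodic_eqI[of _ "length w"])
    show "pext ?w \<in> periodic (length w)" using pext_periodic[of ?w] unfolding len .
    show "shift r (pext w) i = pext ?w i" if "i < length w" for i
    proof -
      have "pext w (r + i) = ?w ! i"
      proof (cases "r + i < length w")
        case True
        then show ?thesis using r by (simp add: pext_nth nth_append less_diff_conv add.commute)
      next
        case False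
        then have "pext w (r + i) = pext w (r + i - length w)"
          using periodic_add[OF pext_periodic, of w "r + i - length w"] by simp
        moreover have "r + i - length w < r" "\<not> i < length w - r" "i - (length w - r) = r + i - length w"
          using False r that by linarith+
        ultimately show ?thesis using r that by (simp add: pext_nth nth_append del: diff_diff_right diff_diff_left)
      qed
      then show ?thesis using that len by (simp add: shift_def pext_nth)
    qed
  qed (use False in \<open>auto simp: pext_periodic shift_periodic\<close>)
qed (simp add: shift_def pext_def)

text \<open>One summand of \<open>rho\<close> up to sign, for the cut at position
  \<open>N - 1\<close>; the other cuts are reached by shifting. A cut at \<open>z\<close> counts as
  \<open>0\<close>.\<close>

definition open_at_y :: "nat \<Rightarrow> (nat \<Rightarrow> letter) \<Rightarrow> H" where
  "open_at_y N g = (if g (N - 1) = Ly then hx * zy_mon (map g [0..<N - 1]) * hy else 0)"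

text \<open>Cuts inside the block \<open>z^n\<close> contribute \<open>0\<close>, so the sum may run
  over all rotations. In this form it visibly depends on the necklace only.\<close>

lemma rho_zy_mon_cyclic:
  defines "F \<equiv> \<lambda>n w. pext (replicate n Lx @ w)"
  shows "rho n (zy_mon w) = - (\<Sum>r<n + length w. open_at_y (n + length w) (shift (Suc r) (F n w)))"
proof -
  let ?N = "n + length w" and ?W = "replicate n Lx @ w"
  have "open_at_y ?N (shift (Suc r) (F n w)) = 0" if "r < n" for r
  proof -
    have "shift (Suc r) (F n w) (?N - 1) = pext ?W (r + length ?W)"
      using that by (simp add: F_def shift_def)
    also have "\<dots> = pext ?W r"
      by (rule periodic_add[OF pext_periodic])
    also have "\<dots> = Lx"
      using that by (simp add: pext_nth nth_append)
    finally show ?thesis by (simp add: open_at_y_def)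
  qed
  \<comment> \<open>The shift by \<open>Suc (n + i)\<close> brings \<open>w ! i\<close>, found at
    position \<open>n + i\<close>, to the last position.\<close>
  moreover have "open_at_y ?N (shift (Suc (n + i)) (F n w)) =
      (if w ! i = Ly then hx * zy_mon (drop (Suc i) w @ replicate n Lx @ take i w) * hy else 0)"
    if i: "i < length w" for i
  proof -
    let ?U = "drop (Suc i) w @ replicate n Lx @ take i w"
    have "shift (Suc (n + i)) (F n w) = pext (?U @ [w ! i])"
      using i by (simp add: F_def shift_pext take_Suc_conv_app_nth)
    moreover have "length ?U = ?N - 1" using i by simp
    moreover have "map (pext (U @ [a])) [0..<length U] = U" for U and a :: letter
      by (rule nth_equalityI) (simp_all add: pext_nth nth_append)
    moreover have "pext (U @ [a]) (length U) = a" for U and a :: letter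
      by (simp add: pext_nth)
    ultimately show ?thesis unfolding open_at_y_def by metis
  qed
  moreover have "(\<Sum>r<n + m. g r) = (\<Sum>r<n. g r) + (\<Sum>i<m. g (n + i))" for g :: "nat \<Rightarrow> H" and m
    by (induction m) (simp_all add: add.assoc)
  ultimately show ?thesis by (simp add: rho_zy_mon)
qed

section \<open>Coefficients of \<open>rho\<close> with respect to words in \<open>z\<close> and
  \<open>y\<close>\<close>

definition words_y :: "nat \<Rightarrow> word set" where
  "words_y k = {w. length w = k \<and> w \<noteq> [] \<and> last w = Ly}"

lemma finite_words_y: "finite (words_y k)"
  by (rule finite_subset[OF _ finite_lists_length_eq[of "UNIV :: letter set" k]]) (auto simp: words_y_def)

definition coeff_at :: "word \<Rightarrow> H \<Rightarrow> rat" where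
  "coeff_at t p = Poly_Mapping.lookup (zy_coords (strip p)) t"

lemma coeff_at_linear:
  "coeff_at t (p + q) = coeff_at t p + coeff_at t q" "coeff_at t (p - q) = coeff_at t p - coeff_at t q"
  "coeff_at t (- p) = - coeff_at t p"
  "coeff_at t (scale c p) = c * coeff_at t p" "coeff_at t 0 = 0"
  by (simp_all add: coeff_at_def strip_def zy_coords_def linext_add linext_diff linext_scale
      linext_uminus lookup_add lookup_minus)

lemma coeff_at_sum: "coeff_at t (sum g A) = (\<Sum>i\<in>A. coeff_at t (g i))"
  by (induction A rule: infinite_finite_induct) (simp_all add: coeff_at_linear)

text \<open>The cut deletes the final \<open>Ly\<close>, hence \<open>butlast w\<close>. As
  \<open>open_at_y\<close> demands that letter, the shortened word still determines
  \<open>g\<close>.\<close>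

lemma coeff_at_open_at_y:
  assumes "g \<in> periodic (length w)" "w \<noteq> []" "last w = Ly"
  shows "coeff_at (butlast w) (open_at_y (length w) g) = (if g = pext w then 1 else 0)"
proof -
  let ?N = "length w"
  have "coeff_at (butlast w) (open_at_y ?N g) =
      (if g (?N - 1) = Ly \<and> map g [0..<?N - 1] = butlast w then 1 else 0)"
    by (auto simp: open_at_y_def coeff_at_linear(5))
      (simp_all add: coeff_at_def strip_hx_hy zy_coords_zy_mon, simp_all add: mon_def lookup_single)
  also have "g (?N - 1) = Ly \<and> map g [0..<?N - 1] = butlast w \<longleftrightarrow> map g [0..<?N] = w"
  proof -
    have "map g [0..<?N] = map g [0..<?N - 1] @ [g (?N - 1)]"
      using assms(2) by (cases ?N) auto
    moreover have "w = butlast w @ [Ly]" using assms(2,3) by (metis append_butlast_last_id)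
    ultimately show ?thesis by (metis butlast_snoc last_snoc)
  qed
  also have "\<dots> \<longleftrightarrow> g = pext w"
    using assms(2) pext_map_upt[OF assms(1)] by (auto intro!: nth_equalityI simp: pext_nth)
  finally show ?thesis .
qed

text \<open>Every rotation of \<open>z^n w\<close> that equals \<open>z^n v\<close> contributes
  \<open>-1\<close>. By \<open>cnt_pos_iff\<close> the coefficient is therefore nonzero exactly when
  both lie on the same necklace.\<close>

lemma coeff_rho:
  assumes "length w = length v" "v \<noteq> []" "last v = Ly"
  shows "coeff_at (butlast (replicate n Lx @ v)) (rho n (zy_mon w)) =
    - of_nat (cnt (n + length v) (pext (replicate n Lx @ w)) (pext (replicate n Lx @ v)))"
proof -
  let ?V = "replicate n Lx @ v" and ?W = "replicate n Lx @ w"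
  have "coeff_at (butlast ?V) (open_at_y (n + length v) (shift (Suc r) (pext ?W))) =
      (if shift (Suc r) (pext ?W) = pext ?V then 1 else 0)" for r
    using coeff_at_open_at_y[of "shift (Suc r) (pext ?W)" ?V] assms
      shift_periodic[OF pext_periodic, of "Suc r" ?W] by simp
  then show ?thesis
    using assms(1) by (auto simp: rho_zy_mon_cyclic coeff_at_linear(3) coeff_at_sum cnt_def intro!: sum.cong)
qed

lemma rho_zy_mon_cong:
  assumes "length w = length v" "orb (pext (replicate n Lx @ w)) = orb (pext (replicate n Lx @ v))"
  shows "rho n (zy_mon w) = rho n (zy_mon v)"
proof -
  obtain s where "pext (replicate n Lx @ v) = shift s (pext (replicate n Lx @ w))"
    using assms(2) orb_self[of "pext (replicate n Lx @ v)"] by (auto simp: orb_def)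
  then show ?thesis
    using sum_shifts_shift[of "pext (replicate n Lx @ w)" "n + length v" "open_at_y (n + length v)" s]
      assms(1) pext_periodic[of "replicate n Lx @ w"]
    by (simp add: rho_zy_mon_cyclic)
qed

section \<open>The space \<open>Hcheck k\<close> in terms of \<open>z\<close> and \<open>y\<close>\<close>

lemma last_Ly_blocks:
  assumes "w = [] \<or> last w = Ly"
  obtains ks where "\<forall>i\<in>set ks. i \<ge> 1" "concat (map (\<lambda>i. replicate (i - 1) Lx @ [Ly]) ks) = w"
  using assms
proof (induction "length w" arbitrary: w thesis rule: less_induct)
  case less
  show thesis
  proof (cases "w = []")
    case True
    then show ?thesis using less.prems(1)[of "[]"] by simp
  next
    case False
    then have "Ly \<in> set w" using less.prems(2) last_in_set by metis
    then obtain p v where w: "w = replicate p Lx @ Ly # v" by (rule first_Ly)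
    have "v = [] \<or> last v = Ly" using less.prems(2) w by (cases "v = []") auto
    moreover have "length v < length w" using w by simp
    ultimately obtain ks where "\<forall>i\<in>set ks. i \<ge> 1"
      "concat (map (\<lambda>i. replicate (i - 1) Lx @ [Ly]) ks) = v"
      using less.hyps by blast
    then show ?thesis using less.prems(1)[of "Suc p # ks"] w by auto
  qed
qed

text \<open>Cutting behind each \<open>Ly\<close> writes a word as a product of factors
  \<open>zk i\<close>, and the powers of \<open>y\<close> are those with all \<open>i = 1\<close>.
  Under \<open>mon\<close> the letter \<open>Lx\<close> of a word in \<open>words_y k\<close> stands
  for \<open>x\<close>, under \<open>zy_mon\<close> for \<open>z\<close>.\<close>

lemma Hcheck_eq: "Hcheck k = pm.span (mon ` (words_y k - {replicate k Ly}))"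
proof -
  let ?Z = "\<lambda>ks. concat (map (\<lambda>i. replicate (i - 1) Lx @ [Ly]) ks)"
  have zk: "zk i = mon (replicate (i - 1) Lx @ [Ly])" for i
    by (simp add: zk_def mon_append mon_replicate hx_def hy_def)
  have prod: "prod_list (map zk ks) = mon (?Z ks)" for ks
    by (induction ks) (simp_all add: zk mon_Nil flip: mon_append)
  have len: "length (?Z ks) = sum_list ks" if "\<forall>i\<in>set ks. i \<ge> 1" for ks
    using that by (induction ks) auto
  have last: "?Z ks \<noteq> []" "last (?Z ks) = Ly" if "ks \<noteq> []" for ks
    using that by (induction ks rule: rev_induct) auto
  have ones: "?Z ks = replicate (sum_list ks) Ly \<longleftrightarrow> (\<forall>i\<in>set ks. i = 1)"
    if "\<forall>i\<in>set ks. i \<ge> 1" for ks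
  proof
    assume "?Z ks = replicate (sum_list ks) Ly"
    then have "Lx \<notin> set (?Z ks)" by (metis in_set_replicate letter.distinct(1))
    then have "\<forall>i\<in>set ks. i - 1 = 0" by (auto split: if_splits)
    with that show "\<forall>i\<in>set ks. i = 1" by force
  next
    assume "\<forall>i\<in>set ks. i = 1"
    then show "?Z ks = replicate (sum_list ks) Ly" by (induction ks) auto
  qed
  have "{prod_list (map zk ks) | ks. ks \<noteq> [] \<and> (\<forall>i\<in>set ks. i \<ge> 1) \<and> sum_list ks = k \<and>
      \<not> (\<forall>i\<in>set ks. i = 1)} = mon ` (words_y k - {replicate k Ly})"
  proof (intro equalityI subsetI)
    fix p assume "p \<in> {prod_list (map zk ks) | ks. ks \<noteq> [] \<and> (\<forall>i\<in>set ks. i \<ge> 1) \<and> sum_list ks = k \<and>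
      \<not> (\<forall>i\<in>set ks. i = 1)}"
    then obtain ks where ks: "p = mon (?Z ks)" "ks \<noteq> []" "\<forall>i\<in>set ks. i \<ge> 1" "sum_list ks = k"
      "\<not> (\<forall>i\<in>set ks. i = 1)" by (auto simp: prod)
    then have "?Z ks \<in> words_y k - {replicate k Ly}"
      using len[of ks] last[of ks] ones[of ks] by (simp add: words_y_def)
    then show "p \<in> mon ` (words_y k - {replicate k Ly})" unfolding ks(1) by (rule imageI)
  next
    fix p assume "p \<in> mon ` (words_y k - {replicate k Ly})"
    then obtain w where w: "p = mon w" "w \<in> words_y k" "w \<noteq> replicate k Ly" by auto
    then obtain ks where ks: "\<forall>i\<in>set ks. i \<ge> 1" "?Z ks = w"
      using last_Ly_blocks[of w] by (auto simp: words_y_def)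
    have "ks \<noteq> []" "sum_list ks = k" using w ks(2) len[OF ks(1)] by (auto simp: words_y_def)
    moreover have "\<not> (\<forall>i\<in>set ks. i = 1)" using ones[OF ks(1)] w ks(2) \<open>sum_list ks = k\<close> by simp
    moreover have "p = prod_list (map zk ks)" using w(1) ks(2) prod by simp
    ultimately show "p \<in> {prod_list (map zk ks) | ks. ks \<noteq> [] \<and> (\<forall>i\<in>set ks. i \<ge> 1) \<and> sum_list ks = k \<and>
      \<not> (\<forall>i\<in>set ks. i = 1)}" using ks(1) by blast
  qed
  then show ?thesis by (simp add: Hcheck_def)
qed

text \<open>Expanding \<open>z = x + y\<close> yields \<open>y^k\<close> exactly once, and the other
  monomials span \<open>Hcheck k\<close>.\<close>

lemma zy_mon_diff_Hcheck:
  assumes "w \<in> words_y k"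
  shows "zy_mon w - mon (replicate k Ly) \<in> Hcheck k"
  using assms
proof (induction w arbitrary: k)
  case Nil
  then show ?case by (simp add: words_y_def)
next
  case (Cons a w)
  then obtain j where k: "k = Suc j" "length w = j" by (auto simp: words_y_def)
  have mult: "mon [b] * p \<in> Hcheck (Suc j)" if "p \<in> Hcheck j" for b p
  proof -
    have "mon [b] * mon u \<in> Hcheck (Suc j)" if "u \<in> words_y j - {replicate j Ly}" for u
      unfolding Hcheck_eq mon_append[symmetric]
      by (intro pm.span_base imageI) (use that in \<open>auto simp: words_y_def\<close>)
    then show ?thesis
      using that span_image_times_left[of p mon] unfolding Hcheck_eq by blast
  qed
  show ?case
  proof (cases "w = []")
    case True
    then show ?thesis
      using Cons.prems k by (simp add: words_y_def Hcheck_eq pm.span_zero hy_def)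
  next
    case False
    then have w: "w \<in> words_y j" using Cons.prems k by (simp add: words_y_def)
    let ?D = "zy_mon w - mon (replicate j Ly)"
    have D: "?D \<in> Hcheck j" by (rule Cons.IH[OF w])
    have y: "mon (replicate k Ly) = hy * mon (replicate j Ly)"
      using mon_Cons[of Ly "replicate j Ly"] k by (simp add: hy_def)
    show ?thesis
    proof (cases a)
      case Ly
      then have "zy_mon (a # w) - mon (replicate k Ly) = mon [Ly] * ?D"
        unfolding y by (simp add: hy_def right_diff_distrib)
      then show ?thesis using mult[OF D] k by simp
    next
      case Lx
      have "mon (Lx # replicate j Ly) \<in> Hcheck k"
        unfolding Hcheck_eq
        by (intro pm.span_base imageI) (use k w in \<open>auto simp: words_y_def\<close>)
      \<comment> \<open>This expands \<open>(x + y) (D + y^j) - y^k\<close> with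
        \<open>k = j + 1\<close>, where \<open>D\<close> is the difference for
        \<open>w\<close>.\<close>
      moreover have "zy_mon (a # w) - mon (replicate k Ly) =
          mon [Lx] * ?D + mon [Ly] * ?D + mon (Lx # replicate j Ly)"
        unfolding y mon_Cons[of Lx "replicate j Ly"]
        using Lx by (simp add: hy_def hx_def hz_def algebra_simps)
      ultimately show ?thesis
        using mult[OF D] k unfolding Hcheck_eq by (simp add: pm.span_add)
    qed
  qed
qed

lemma zy_mon_diff_zy_mon_Hcheck:
  "u \<in> words_y k \<Longrightarrow> v \<in> words_y k \<Longrightarrow> zy_mon u - zy_mon v \<in> Hcheck k"
  using pm.span_diff[of "zy_mon u - mon (replicate k Ly)" _ "zy_mon v - mon (replicate k Ly)"]
    zy_mon_diff_Hcheck[of u k] zy_mon_diff_Hcheck[of v k] by (simp add: Hcheck_eq)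

text \<open>Each \<open>x\<close> in \<open>a\<close> is replaced by \<open>z - y\<close>. The
  suffix \<open>s\<close> stays fixed, so that a final \<open>y\<close> can be preserved.\<close>

lemma mon_span_zy_mon:
  "mon a * zy_mon s \<in> pm.span (zy_mon ` {u @ s | u. length u = length a})"
proof (induction a)
  case Nil
  then show ?case by (auto simp: mon_Nil intro: pm.span_base)
next
  case (Cons c a)
  let ?S = "\<lambda>l. pm.span (zy_mon ` {u @ s | u. length u = l})"
  have mult: "zy b * (mon a * zy_mon s) \<in> ?S (Suc (length a))" for b
  proof (rule span_image_times_left[OF Cons])
    fix w assume "w \<in> {u @ s | u. length u = length a}"
    then obtain u where u: "w = u @ s" "length u = length a" by blast
    then have "zy b * zy_mon w = zy_mon ((b # u) @ s)" by (simp add: mult.assoc)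
    moreover have "(b # u) @ s \<in> {u @ s | u. length u = Suc (length a)}"
      using u by (intro CollectI exI[of _ "b # u"]) simp
    ultimately show "zy b * zy_mon w \<in> ?S (Suc (length a))"
      by (metis (no_types, lifting) imageI pm.span_base)
  qed
  have "mon [c] * (mon a * zy_mon s) \<in> ?S (Suc (length a))"
  proof (cases c)
    case Lx
    then have "mon [c] = zy Lx - zy Ly" by (simp add: hz_def hx_def)
    then show ?thesis using pm.span_diff[OF mult[of Lx] mult[of Ly]] by (simp add: left_diff_distrib)
  next
    case Ly
    then show ?thesis using mult[of Ly] by (simp add: hy_def)
  qed
  then show ?case by (simp add: mon_Cons[of c a] mult.assoc)
qed

text \<open>A monomial of \<open>Hcheck k\<close> contains a letter \<open>x = z - y\<close>.
  Keeping this one difference intact while the other letters are expanded in \<open>z\<close> and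
  \<open>y\<close> leaves a combination of differences of words.\<close>

lemma Hcheck_subset_span:
  "Hcheck k \<subseteq> pm.span {zy_mon u - zy_mon v | u v. u \<in> words_y k \<and> v \<in> words_y k}"
proof -
  let ?D = "{zy_mon u - zy_mon v | u v. u \<in> words_y k \<and> v \<in> words_y k}"
  have "mon w \<in> pm.span ?D" if "w \<in> words_y k - {replicate k Ly}" for w
  proof -
    have "Lx \<in> set w"
    proof (rule ccontr)
      assume "Lx \<notin> set w"
      then have "\<And>a. a \<in> set w \<Longrightarrow> a = Ly" by (metis (full_types) letter.exhaust)
      then have "w = replicate k Ly" using that by (intro replicate_eqI) (auto simp: words_y_def)
      then show False using that by simp
    qed
    then obtain a b where "w = a @ Lx # b" by (meson split_list)
    moreover from this have "b \<noteq> []" "last b = Ly" using that by (auto simp: words_y_def split: if_splits)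
    ultimately obtain c where w: "w = a @ Lx # c @ [Ly]" by (metis append_butlast_last_id)
    then have k: "k = length a + length c + 2" using that by (auto simp: words_y_def)
    have base: "zy_mon u * ((hz - hy) * zy_mon (v @ [Ly])) \<in> pm.span ?D"
      if "length u = length a" "length v = length c" for u v
    proof -
      have "zy_mon u * ((hz - hy) * zy_mon (v @ [Ly])) =
          zy_mon (u @ Lx # v @ [Ly]) - zy_mon (u @ Ly # v @ [Ly])"
        by (simp add: algebra_simps)
      moreover have "u @ Lx # v @ [Ly] \<in> words_y k" "u @ Ly # v @ [Ly] \<in> words_y k"
        using that k by (auto simp: words_y_def)
      ultimately show ?thesis by (intro pm.span_base) blast
    qed
    \<comment> \<open>The letters behind the chosen \<open>x\<close> are expanded first, then those
      before it.\<close>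
    have right: "zy_mon u * ((hz - hy) * (mon c * zy_mon [Ly])) \<in> pm.span ?D"
      if u: "length u = length a" for u
      unfolding mult.assoc[of "zy_mon u" "hz - hy", symmetric]
    proof (rule span_image_times_left[OF mon_span_zy_mon])
      fix x assume "x \<in> {v @ [Ly] | v. length v = length c}"
      then show "zy_mon u * (hz - hy) * zy_mon x \<in> pm.span ?D"
        using base[OF u] unfolding mult.assoc by blast
    qed
    have "(mon a * zy_mon []) * ((hz - hy) * (mon c * zy_mon [Ly])) \<in> pm.span ?D"
    proof (rule span_image_times_right[OF mon_span_zy_mon])
      fix x assume "x \<in> {u @ [] :: word | u. length u = length a}"
      then show "zy_mon x * ((hz - hy) * (mon c * zy_mon [Ly])) \<in> pm.span ?D"
        using right[of x] by simp
    qed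
    moreover have "mon w = mon a * ((hz - hy) * (mon c * hy))"
      by (simp add: w mon_append mon_Cons[of Lx "c @ [Ly]"] hz_def hx_def hy_def mult.assoc)
    ultimately show ?thesis by simp
  qed
  then show ?thesis unfolding Hcheck_eq
    by (intro pm.span_minimal pm.subspace_span) auto
qed

lemma rho_Hcheck_subset_span:
  "rho n ` Hcheck k \<subseteq>
    pm.span {rho n (zy_mon u) - rho n (zy_mon v) | u v. u \<in> words_y k \<and> v \<in> words_y k}" (is "_ \<subseteq> pm.span ?E")
proof
  fix q assume "q \<in> rho n ` Hcheck k"
  then obtain p where "q = rho n p"
    "p \<in> pm.span {zy_mon u - zy_mon v | u v. u \<in> words_y k \<and> v \<in> words_y k}"
    using Hcheck_subset_span by blast
  from this(2) have "rho n p \<in> pm.span ?E"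
  proof (induction rule: pm.span_induct_alt)
    case (step c x y)
    then have "rho n x \<in> ?E" by (auto simp: rho_linear) blast
    with step show ?case by (simp add: rho_linear pm.span_add pm.span_scale pm.span_base)
  qed (simp add: rho_linear pm.span_zero)
  then show "q \<in> pm.span ?E" using \<open>q = _\<close> by simp
qed

section \<open>Necklaces and the dimension\<close>

lemma has_run_replicate_append:
  assumes "w \<noteq> []"
  shows "has_run n Lx (pext (replicate n Lx @ w))"
  using assms unfolding has_run_def by (intro exI[of _ 0]) (auto simp: pext_nth nth_append)

lemma pext_last: "w \<noteq> [] \<Longrightarrow> pext w (length w - 1) = last w"
  by (simp add: pext_nth last_conv_nth)

text \<open>The last \<open>y\<close> preceding a run is rotated to the end; the word then begins
  with \<open>n\<close> letters \<open>z\<close>.\<close>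

lemma has_run_shift_normal_form:
  assumes f: "f \<in> periodic (n + k)" and run: "has_run n Lx f" and y: "f j = Ly" and "k \<ge> 1"
  obtains r w where "w \<in> words_y k" "shift r f = pext (replicate n Lx @ w)"
proof -
  let ?N = "n + k"
  obtain s where s: "\<And>i. i < n \<Longrightarrow> f (s + i) = Lx" using run by (auto simp: has_run_def)
  \<comment> \<open>The run is moved beyond position \<open>j\<close>, so that some
    \<open>Ly\<close> precedes it.\<close>
  define s' where "s' = s + (j + 1) * ?N"
  have s': "f (s' + i) = Lx" if "i < n" for i
    using s[OF that] periodic_add_mult[OF f, of "s + i" "j + 1"] by (simp add: s'_def add_ac)
  have "(j + 1) * 1 \<le> (j + 1) * ?N" using \<open>k \<ge> 1\<close> by (intro mult_le_mono2) simp
  then have "j < s'" by (simp add: s'_def)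
  define t where "t = (GREATEST i. i < s' \<and> f i = Ly)"
  have t: "t < s'" "f t = Ly"
    using GreatestI_nat[of "\<lambda>i. i < s' \<and> f i = Ly" j s'] \<open>j < s'\<close> y unfolding t_def by auto
  have greatest: "i \<le> t" if "i < s'" "f i = Ly" for i
    using Greatest_le_nat[of "\<lambda>i. i < s' \<and> f i = Ly" i s'] that unfolding t_def by auto
  \<comment> \<open>Strictly between \<open>t\<close> and \<open>s'\<close> all letters are
    \<open>Lx\<close>, and the run supplies \<open>n\<close> more from \<open>s'\<close> on.\<close>
  have start: "f (Suc t + i) = Lx" if "i < n" for i
  proof (cases "Suc t + i < s'")
    case True
    then show ?thesis using greatest[of "Suc t + i"] by (cases "f (Suc t + i)") auto
  next
    case False
    then show ?thesis using s'[of "Suc t + i - s'"] t that by simp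
  qed
  define g where "g = shift (Suc t) f"
  have g: "g \<in> periodic ?N" unfolding g_def by (rule shift_periodic[OF f])
  define w where "w = map g [n..<?N]"
  have "map g [0..<?N] = map g [0..<n] @ w"
    unfolding w_def using upt_add_eq_append[of 0 n k] by simp
  also have "map g [0..<n] = replicate n Lx"
    using start by (intro replicate_eqI) (auto simp: g_def shift_def)
  finally have "pext (replicate n Lx @ w) = g"
    using pext_map_upt[OF g] \<open>k \<ge> 1\<close> by simp
  moreover have "w \<in> words_y k"
  proof -
    have "last w = g (?N - 1)" unfolding w_def using \<open>k \<ge> 1\<close> by (simp add: last_map)
    also have "\<dots> = f (t + ?N)" using \<open>k \<ge> 1\<close> by (simp add: g_def shift_def)
    finally show ?thesis using t \<open>k \<ge> 1\<close> by (simp add: words_y_def w_def periodic_add[OF f])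
  qed
  ultimately show ?thesis using that unfolding g_def by metis
qed

text \<open>A sequence with the run and some \<open>y\<close> has a rotation in normal form; without
  any \<open>y\<close> it is constant.\<close>

lemma necklaces_eq:
  assumes "k \<ge> 1"
  shows "orb ` {f \<in> periodic (n + k). has_run n Lx f} =
    insert (orb (\<lambda>_. Lx)) ((\<lambda>w. orb (pext (replicate n Lx @ w))) ` words_y k)" (is "orb ` ?X = ?R")
proof (intro equalityI subsetI)
  fix Q assume "Q \<in> orb ` ?X"
  then obtain f where f: "Q = orb f" "f \<in> periodic (n + k)" "has_run n Lx f" by auto
  show "Q \<in> ?R"
  proof (cases "\<exists>j. f j = Ly")
    case True
    then obtain r w where "w \<in> words_y k" "shift r f = pext (replicate n Lx @ w)"
      using has_run_shift_normal_form[OF f(2,3) _ assms] by metis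
    then show ?thesis using orb_shift[OF f(2), of r] f(1) assms by auto
  next
    case False
    then have "f = (\<lambda>_. Lx)" by (metis (full_types) letter.exhaust)
    then show ?thesis using f(1) by simp
  qed
next
  fix Q assume "Q \<in> ?R"
  moreover have "(\<lambda>_. Lx) \<in> ?X" by (simp add: periodic_def has_run_def)
  moreover have "pext (replicate n Lx @ w) \<in> ?X" if "w \<in> words_y k" for w
    using that pext_periodic[of "replicate n Lx @ w"] has_run_replicate_append[of w n]
    by (auto simp: words_y_def)
  ultimately show "Q \<in> orb ` ?X" by blast
qed

lemma orb_const_neq:
  assumes "w \<in> words_y k"
  shows "orb (\<lambda>_. Lx) \<noteq> orb (pext (replicate n Lx @ w))"
proof
  let ?W = "replicate n Lx @ w"
  assume "orb (\<lambda>_. Lx) = orb (pext ?W)"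
  then have "pext ?W \<in> orb (\<lambda>_. Lx)" using orb_self by metis
  then have "pext ?W (length ?W - 1) = Lx" by (auto simp: orb_def shift_def)
  then show False using assms pext_last[of ?W] by (simp add: words_y_def)
qed

text \<open>Words on the same necklace have equal images, and \<open>Hcheck k\<close> provides only
  differences. A basis is therefore given by \<open>v w\<close>, with one \<open>w\<close> for each
  necklace other than that of \<open>w0\<close>.\<close>

lemma dim_rho_Hcheck:
  assumes "k \<ge> 1"
  shows "int (pm.dim (rho n ` Hcheck k)) = int (card (orb ` {f \<in> periodic (n + k). has_run n Lx f})) - 2"
proof -
  define cls where "cls = (\<lambda>w. orb (pext (replicate n Lx @ w)))"
  define E where "E = (\<lambda>w. rho n (zy_mon w))"
  let ?W = "words_y k"
  \<comment> \<open>\<open>S\<close> contains exactly one word for each necklace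
    \<open>cls w\<close>.\<close>
  obtain S where S: "S \<subseteq> ?W" "inj_on cls S" "cls ` ?W = cls ` S"
    using subset_image_inj[of "cls ` ?W" cls ?W] by auto
  define w0 where "w0 = replicate (k - 1) Lx @ [Ly]"
  have w0: "w0 \<in> ?W" using assms by (simp add: w0_def words_y_def)
  \<comment> \<open>The base word \<open>w0\<close> need not lie in \<open>S\<close>, so its class
    is excluded rather than the word itself.\<close>
  define I where "I = {w \<in> S. cls w \<noteq> cls w0}"
  define v where "v = (\<lambda>w. E w - E w0)"
  have finI: "finite I" using finite_subset[OF S(1) finite_words_y] by (simp add: I_def)
  have E_cong: "E u = E w" if "u \<in> ?W" "w \<in> ?W" "cls u = cls w" for u w
    using that rho_zy_mon_cong[of u w n] by (simp add: E_def cls_def words_y_def)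
  have coeff: "coeff_at (butlast (replicate n Lx @ u)) (E w) \<noteq> 0 \<longleftrightarrow> cls u = cls w"
    if "u \<in> ?W" "w \<in> ?W" for u w
  proof -
    have w: "pext (replicate n Lx @ w) \<in> periodic (n + k)"
      using pext_periodic[of "replicate n Lx @ w"] that by (simp add: words_y_def)
    have N: "n + k > 0" using assms by simp
    have "coeff_at (butlast (replicate n Lx @ u)) (E w) =
        - of_nat (cnt (n + k) (pext (replicate n Lx @ w)) (pext (replicate n Lx @ u)))"
      using coeff_rho[of w u n] that by (simp add: E_def words_y_def)
    then have "coeff_at (butlast (replicate n Lx @ u)) (E w) \<noteq> 0 \<longleftrightarrow> cls w = cls u"
      unfolding cls_def orb_eq_iff[OF w N] cnt_pos_iff[OF w N, symmetric] by simp
    then show ?thesis by metis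
  qed
  have diag: "coeff_at (butlast (replicate n Lx @ u)) (v u) \<noteq> 0" if "u \<in> I" for u
    using that coeff[of u u] coeff[of u w0] w0 S(1) by (auto simp: I_def v_def coeff_at_linear)
  have off_diag: "coeff_at (butlast (replicate n Lx @ u)) (v w) = 0"
    if "w \<in> I" "u \<in> I" "w \<noteq> u" for u w
  proof -
    have "u \<in> ?W" "w \<in> ?W" "cls u \<noteq> cls w0" "cls u \<noteq> cls w"
      using that S(1) inj_on_eq_iff[OF S(2), of u w] by (simp_all add: I_def subset_iff)
    then show ?thesis
      using coeff[of u w] coeff[of u w0] w0 by (simp add: v_def coeff_at_linear)
  qed
  \<comment> \<open>The functional for \<open>u\<close> detects only the necklace of
    \<open>u\<close>, so it vanishes on \<open>E w0\<close> and on every other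
    representative.\<close>
  note functionals = independent_by_functionals[where l = "\<lambda>u. coeff_at (butlast (replicate n Lx @ u))",
      OF finI coeff_at_linear(1) coeff_at_linear(4) diag off_diag]
  have inj: "inj_on v I" and indep: "pm.independent (v ` I)"
    by (rule functionals; assumption)+
  have "v ` I \<subseteq> rho n ` Hcheck k"
  proof
    fix p assume "p \<in> v ` I"
    then obtain w where "w \<in> ?W" "p = rho n (zy_mon w - zy_mon w0)"
      using S(1) by (auto simp: I_def v_def E_def rho_linear)
    then show "p \<in> rho n ` Hcheck k" using zy_mon_diff_zy_mon_Hcheck w0 by blast
  qed
  moreover have "rho n ` Hcheck k \<subseteq> pm.span (v ` I)"
  proof -
    have span: "v u \<in> pm.span (v ` I)" if u: "u \<in> ?W" for u
    proof -
      obtain s where s: "s \<in> S" "cls s = cls u" using S(3) u by (metis imageE imageI)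
      then have "v u = v s" using E_cong[of u s] u S(1) by (auto simp: v_def)
      \<comment> \<open>A representative outside \<open>I\<close> lies on the necklace of
        \<open>w0\<close>, so its difference is zero.\<close>
      moreover have "v s = 0" if "s \<notin> I"
        using that s S(1) w0 E_cong[of s w0] by (auto simp: I_def v_def)
      ultimately show ?thesis by (cases "s \<in> I") (auto simp: pm.span_base pm.span_zero)
    qed
    have "{E u - E w | u w. u \<in> ?W \<and> w \<in> ?W} \<subseteq> pm.span (v ` I)"
    proof
      fix p assume "p \<in> {E u - E w | u w. u \<in> ?W \<and> w \<in> ?W}"
      then obtain u w where "u \<in> ?W" "w \<in> ?W" "p = v u - v w" by (auto simp: v_def)
      then show "p \<in> pm.span (v ` I)" by (simp add: pm.span_diff span)
    qed
    then have "pm.span {E u - E w | u w. u \<in> ?W \<and> w \<in> ?W} \<subseteq> pm.span (v ` I)"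
      by (intro pm.span_minimal pm.subspace_span)
    then show ?thesis using rho_Hcheck_subset_span[of n k] unfolding E_def by order
  qed
  ultimately have "pm.dim (rho n ` Hcheck k) = card (v ` I)"
    using indep by (rule pm.dim_unique) simp
  also have "\<dots> = card (cls ` I)"
    using inj S(2) by (metis (no_types, lifting) I_def card_image inj_on_subset mem_Collect_eq subsetI)
  also have "cls ` I = cls ` ?W - {cls w0}" unfolding S(3) by (auto simp: I_def)
  also have "card \<dots> = card (cls ` ?W) - 1" using w0 by (simp add: card_Diff_singleton)
  finally have "pm.dim (rho n ` Hcheck k) = card (cls ` ?W) - 1" .
  moreover have "card (cls ` ?W) > 0"
    using w0 finite_words_y[of k] by (auto simp: card_gt_0_iff)
  \<comment> \<open>The constant necklace has the run but no \<open>y\<close>, so it is not among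
    the classes; with the loss of the class of \<open>w0\<close> this accounts for the
    \<open>2\<close> subtracted.\<close>
  moreover have "card (orb ` {f \<in> periodic (n + k). has_run n Lx f}) = card (cls ` ?W) + 1"
    unfolding necklaces_eq[OF assms] cls_def
    using orb_const_neq finite_words_y[of k] by (subst card_insert_disjoint) auto
  ultimately show ?thesis by linarith
qed

theorem mainTheorem1:
  fixes n k :: nat
  assumes "k \<ge> 1"
  shows "(of_nat (pm.dim (rho n ` Hcheck k)) :: rat) =
    1 / of_nat (n + k) *
      (\<Sum>m | m dvd n + k. of_nat (totient ((n + k) div m)) * (2 ^ m - of_int (lucas n m))) - 2"
proof -
  define c where "c = int (card (orb ` {f \<in> periodic (n + k). has_run n Lx f}))"
  have "int (n + k) * c = (\<Sum>m | m dvd n + k. int (totient ((n + k) div m)) * (2 ^ m - lucas n m))"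
    unfolding c_def by (rule card_necklaces) (use assms in simp)
  from this[THEN arg_cong[of _ _ "of_int :: int \<Rightarrow> rat"]]
  have "of_nat (n + k) * (of_int c :: rat) =
      (\<Sum>m | m dvd n + k. of_nat (totient ((n + k) div m)) * (2 ^ m - of_int (lucas n m)))"
    by simp
  then have "(of_int c :: rat) = 1 / of_nat (n + k) *
      (\<Sum>m | m dvd n + k. of_nat (totient ((n + k) div m)) * (2 ^ m - of_int (lucas n m)))"
    using assms by (simp add: field_simps del: of_nat_add)
  moreover have "(of_nat (pm.dim (rho n ` Hcheck k)) :: rat) = of_int c - 2"
    using dim_rho_Hcheck[OF assms, of n, THEN arg_cong[of _ _ "of_int :: int \<Rightarrow> rat"]]
    by (simp add: c_def)
  ultimately show ?thesis by simp
qed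

end
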